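(* Let $S=S(t,z,\bar z)$ be any given (smooth) solution on $\mathbf{R}^3$ (coordinates $(t,x,y)$) of the $1+2$ dimensional isotropic Landau-Lifshitz equation in matrix form $$S_t=-\frac{1}{2i}[S,S_{z\bar z}],\qquad S=\begin{pmatrix} s_3 & s_1+is_2\\ s_1-is_2 & -s_3\end{pmatrix},\quad S^2=I .$$ Then there is a gauge function $G(t,z,\bar z)\in SU(2)$ such that $S$ is transformed by the gauge transformation of $G$ to a solution $(p,q,r,u)$ of the nonlinear Schrödinger-type system $$\begin{cases} iq_t-q_{z\bar z}+2uq-2(\bar p q)_z+2pq_{\bar z}+4|p|^2q=0,\\ ir_t+r_{z\bar z}-2ur-2(\bar p r)_z+2pr_{\bar z}-4|p|^2r=0,\\ ip_t=(qr)_{\bar z}-u_z,\end{cases}$$ where $u$ is a real function and $p,q,r$ are complex functions of $(t,x,y)$ satisfying the additional restrictions $$\bar p_z+p_{\bar z}=|q|^2-|r|^2,\qquad \bar r_z+q_{\bar z}=2(p\bar r-\bar p q).$$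
   Context: Here $z=\frac{x+iy}{2}$, $\bar z=\frac{x-iy}{2}$, so $\partial_z=\partial_x-i\partial_y$, $\partial_{\bar z}=\partial_x+i\partial_y$ and $\partial_z\partial_{\bar z}=\partial_x^2+\partial_y^2$. The spin vector $\mathbf{s}=(s_1,s_2,s_3)$ (real entries) takes values in the unit sphere $S^2\subset\mathbf{R}^3$, and the matrix equation is the matrix form of $\mathbf{s}_t=\mathbf{s}\times(\partial_x^2+\partial_y^2)\mathbf{s}$. $[\cdot,\cdot]$ is the matrix commutator and $\bar p_z$ means $\partial_z(\bar p)$, etc. Gauge transformation: put $\sigma_3=\mathrm{diag}(1,-1)$, $U=\begin{pmatrix} p&q\\ r&-p\end{pmatrix}$, $U^{(\text{off-diag})}=\begin{pmatrix}0&q\\ r&0\end{pmatrix}$, $Q=\begin{pmatrix}0&-2q\bar p\\ -2r\bar p&0\end{pmatrix}$. A matrix function $S$ and a quadruple $(p,q,r,u)$ are transformed into each other by the gauge transformation of $G:\mathbf{R}^3\to SU(2)$ when $$S=-G\sigma_3G^{-1},\qquad G_z=-GU,\qquad G_t=-iG\Big(\big(uI+U^{(\text{off-diag})}_{\bar z}\big)\sigma_3+Q\Big).$$ *)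

theory Defs
  imports "HOL-Analysis.Analysis"
begin

text \<open>Points of space-time are triples \<open>(t, x, y)\<close>. A function of \<open>t\<close>, \<open>z\<close> and the conjugate of \<open>z\<close> is a
  function on this space, not necessarily holomorphic in \<open>z\<close>.\<close>

type_synonym point = "real \<times> real \<times> real"

subsection \<open>Smooth functions and partial derivatives\<close>

fun times_cont_differentiable ::
  "nat \<Rightarrow> ('a::real_normed_vector \<Rightarrow> 'b::real_normed_vector) \<Rightarrow> bool" where
  "times_cont_differentiable 0 f \<longleftrightarrow> continuous_on UNIV f"
| "times_cont_differentiable (Suc n) f \<longleftrightarrow>
     (\<forall>a. f differentiable (at a)) \<and>
     (\<forall>v. times_cont_differentiable n (\<lambda>a. frechet_derivative f (at a) v))"

definition smooth :: "('a::real_normed_vector \<Rightarrow> 'b::real_normed_vector) \<Rightarrow> bool" where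
  "smooth f \<longleftrightarrow> (\<forall>n. times_cont_differentiable n f)"

definition d_t :: "(point \<Rightarrow> 'a::real_normed_vector) \<Rightarrow> point \<Rightarrow> 'a" where
  "d_t f a = frechet_derivative f (at a) (1, 0, 0)"

definition d_x :: "(point \<Rightarrow> 'a::real_normed_vector) \<Rightarrow> point \<Rightarrow> 'a" where
  "d_x f a = frechet_derivative f (at a) (0, 1, 0)"

definition d_y :: "(point \<Rightarrow> 'a::real_normed_vector) \<Rightarrow> point \<Rightarrow> 'a" where
  "d_y f a = frechet_derivative f (at a) (0, 0, 1)"

text \<open>Because \<open>z = (x + \<i>y)/2\<close>, the derivatives with respect to \<open>z\<close> and its conjugate carry
  no factor \<open>1/2\<close>. They are given for scalar (\<open>d_z\<close>, \<open>d_zb\<close>) and for matrix functions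
  (\<open>D_z\<close>, \<open>D_zb\<close>).\<close>

definition d_z :: "(point \<Rightarrow> complex) \<Rightarrow> point \<Rightarrow> complex" where
  "d_z f a = d_x f a - \<i> * d_y f a"

definition d_zb :: "(point \<Rightarrow> complex) \<Rightarrow> point \<Rightarrow> complex" where
  "d_zb f a = d_x f a + \<i> * d_y f a"

subsection \<open>Complex 2x2 matrices\<close>

type_synonym cmat2 = "complex^2^2"

definition mat2 :: "complex \<Rightarrow> complex \<Rightarrow> complex \<Rightarrow> complex \<Rightarrow> cmat2" where
  "mat2 a b c d = vector [vector [a, b], vector [c, d]]"

definition cmult :: "complex \<Rightarrow> cmat2 \<Rightarrow> cmat2"  (infixr \<open>*\<^sub>M\<close> 75) where
  "c *\<^sub>M A = map_matrix (\<lambda>a. c * a) A"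

definition commutator :: "cmat2 \<Rightarrow> cmat2 \<Rightarrow> cmat2" where
  "commutator A B = A ** B - B ** A"

definition conj_transpose :: "cmat2 \<Rightarrow> cmat2" where
  "conj_transpose A = map_matrix cnj (transpose A)"

definition SU2 :: "cmat2 set" where
  "SU2 = {A. conj_transpose A ** A = mat 1 \<and> A ** conj_transpose A = mat 1 \<and> det A = 1}"

definition sigma3 :: cmat2 where
  "sigma3 = mat2 1 0 0 (- 1)"

definition D_z :: "(point \<Rightarrow> cmat2) \<Rightarrow> point \<Rightarrow> cmat2" where
  "D_z F a = d_x F a - \<i> *\<^sub>M d_y F a"

definition D_zb :: "(point \<Rightarrow> cmat2) \<Rightarrow> point \<Rightarrow> cmat2" where
  "D_zb F a = d_x F a + \<i> *\<^sub>M d_y F a"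

subsection \<open>The isotropic Landau-Lifshitz equation in matrix form\<close>

definition spin_matrix :: "real^3 \<Rightarrow> cmat2" where
  "spin_matrix s = mat2
     (of_real (s$3)) (of_real (s$1) + \<i> * of_real (s$2))
     (of_real (s$1) - \<i> * of_real (s$2)) (- of_real (s$3))"

text \<open>Since \<open>spin_matrix s ** spin_matrix s\<close> is \<open>(norm s)\<^sup>2\<close> times the identity, the second
  conjunct below says that the spin vector takes values in the unit sphere.\<close>

definition spin_field :: "(point \<Rightarrow> cmat2) \<Rightarrow> (point \<Rightarrow> real^3) \<Rightarrow> bool" where
  "spin_field S s \<longleftrightarrow> (\<forall>a. S a = spin_matrix (s a) \<and> S a ** S a = mat 1)"

definition landau_lifshitz :: "(point \<Rightarrow> cmat2) \<Rightarrow> bool" where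
  "landau_lifshitz S \<longleftrightarrow>
     (\<forall>a. d_t S a = (- (1 / (2 * \<i>))) *\<^sub>M commutator (S a) (D_zb (D_z S) a))"

subsection \<open>The nonlinear Schroedinger-type system\<close>

definition nls_system ::
  "(point \<Rightarrow> complex) \<Rightarrow> (point \<Rightarrow> complex) \<Rightarrow> (point \<Rightarrow> complex) \<Rightarrow> (point \<Rightarrow> real) \<Rightarrow> bool" where
  "nls_system p q r u \<longleftrightarrow> (\<forall>a.
     \<i> * d_t q a - d_zb (d_z q) a + 2 * of_real (u a) * q a
       - 2 * d_z (\<lambda>b. cnj (p b) * q b) a + 2 * p a * d_zb q a
       + 4 * of_real ((cmod (p a))\<^sup>2) * q a = 0 \<and>
     \<i> * d_t r a + d_zb (d_z r) a - 2 * of_real (u a) * r a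
       - 2 * d_z (\<lambda>b. cnj (p b) * r b) a + 2 * p a * d_zb r a
       - 4 * of_real ((cmod (p a))\<^sup>2) * r a = 0 \<and>
     \<i> * d_t p a = d_zb (\<lambda>b. q b * r b) a - d_z (\<lambda>b. of_real (u b)) a)"

definition nls_restrictions ::
  "(point \<Rightarrow> complex) \<Rightarrow> (point \<Rightarrow> complex) \<Rightarrow> (point \<Rightarrow> complex) \<Rightarrow> bool" where
  "nls_restrictions p q r \<longleftrightarrow> (\<forall>a.
     d_z (\<lambda>b. cnj (p b)) a + d_zb p a
       = of_real ((cmod (q a))\<^sup>2) - of_real ((cmod (r a))\<^sup>2) \<and>
     d_z (\<lambda>b. cnj (r b)) a + d_zb q a
       = 2 * (p a * cnj (r a) - cnj (p a) * q a))"

subsection \<open>The gauge transformation\<close>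

definition gauge_U :: "(point \<Rightarrow> complex) \<Rightarrow> (point \<Rightarrow> complex) \<Rightarrow> (point \<Rightarrow> complex) \<Rightarrow> point \<Rightarrow> cmat2"
  where "gauge_U p q r a = mat2 (p a) (q a) (r a) (- p a)"

definition gauge_U_off :: "(point \<Rightarrow> complex) \<Rightarrow> (point \<Rightarrow> complex) \<Rightarrow> point \<Rightarrow> cmat2"
  where "gauge_U_off q r a = mat2 0 (q a) (r a) 0"

definition gauge_Q :: "(point \<Rightarrow> complex) \<Rightarrow> (point \<Rightarrow> complex) \<Rightarrow> (point \<Rightarrow> complex) \<Rightarrow> point \<Rightarrow> cmat2"
  where "gauge_Q p q r a = mat2 0 (- 2 * q a * cnj (p a)) (- 2 * r a * cnj (p a)) 0"

definition gauge_transformation ::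
  "(point \<Rightarrow> cmat2) \<Rightarrow> (point \<Rightarrow> cmat2) \<Rightarrow>
   (point \<Rightarrow> complex) \<Rightarrow> (point \<Rightarrow> complex) \<Rightarrow> (point \<Rightarrow> complex) \<Rightarrow> (point \<Rightarrow> real) \<Rightarrow> bool" where
  "gauge_transformation G S p q r u \<longleftrightarrow> (\<forall>a.
     S a = - (G a ** sigma3 ** matrix_inv (G a)) \<and>
     D_z G a = - (G a ** gauge_U p q r a) \<and>
     d_t G a = (- \<i>) *\<^sub>M (G a **
       ((of_real (u a) *\<^sub>M mat 1 + D_zb (gauge_U_off q r) a) ** sigma3 + gauge_Q p q r a)))"

end

theory Submission
  imports Defs "HOL-Real_Asymp.Real_Asymp"
begin

text \<open>The gauge function is nothing but a smooth diagonalization \<open>S = - G \<sigma>\<^sub>3 G\<^sup>*\<close> with \<open>G\<close> in \<open>SU(2)\<close>. The proof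
  shows that one exists globally, and that each of them transforms \<open>S\<close> to a solution of the system.

  Existence is a topological matter: the first column of \<open>G\<close> is a unit eigenvector of \<open>S\<close> for the
  eigenvalue \<open>-1\<close>, and the second column is determined by the first. So a smooth section of the
  eigenline bundle of \<open>S\<close> over the contractible space-time is wanted. The elementary step
  (\<open>unit_eigenfield_perturb\<close>) transports an eigenvector field of \<open>S\<close> to a nearby involution \<open>T\<close> by
  projecting to the eigenspace of \<open>T\<close> and normalizing. Over a bounded set finitely many such steps
  contract \<open>S\<close> to a constant (\<open>unit_eigenfield_homotopy\<close>). To pass to the whole space, \<open>S\<close> is composed
  with smooth maps of bounded range that are the identity on larger and larger balls; since a step
  does not alter the eigenvector at points where \<open>S\<close> and \<open>T\<close> agree, the fields obtained stabilize near
  each point (\<open>exists_unit_eigenfield\<close>).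

  The rest is the geometry of the frame. With \<open>U = - G\<^sup>* G\<^sub>z\<close> and \<open>V = G\<^sup>* G\<^sub>t\<close>, unitarity and determinant
  \<open>1\<close> make \<open>U\<close> traceless and \<open>V\<close> traceless and skew-Hermitian. The entries of \<open>U\<close> are \<open>p\<close>, \<open>q\<close>, \<open>r\<close>, and
  the imaginary diagonal of \<open>V\<close> gives the real function \<open>u\<close>. Written in the frame, the
  Landau-Lifshitz equation says precisely that the off-diagonal part of \<open>V\<close> is the one that the gauge
  transformation prescribes (\<open>landau_lifshitz_in_frame\<close>). Finally, the mixed derivatives of \<open>G\<close> agree
  (\<open>zero_curvature\<close>): for \<open>z\<close> and its conjugate this is the pair of restrictions, for \<open>z\<close> and \<open>t\<close> it is
  the nonlinear Schroedinger-type system.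

  On the analytic side this needs that smooth functions are closed under products, composition and
  powers, that their second derivatives are symmetric, and a supply of smooth cutoffs from
  \<open>exp (- 1 / x)\<close>.\<close>

section \<open>Smooth functions\<close>

abbreviation dirderiv ::
  "'a::real_normed_vector \<Rightarrow> ('a \<Rightarrow> 'b::real_normed_vector) \<Rightarrow> 'a \<Rightarrow> 'b" where
  "dirderiv v f a \<equiv> frechet_derivative f (at a) v"

lemma times_cont_differentiable_SucI:
  assumes "\<And>a. (f has_derivative f' a) (at a)"
    and "\<And>v. times_cont_differentiable n (\<lambda>a. f' a v)"
  shows "times_cont_differentiable (Suc n) f"
proof -
  have "frechet_derivative f (at a) = f' a" for a
    using frechet_derivative_at[OF assms(1)] by metis
  then show ?thesis using assms by (auto simp: differentiable_def)
qed

lemma times_cont_differentiable_Suc_lower: "times_cont_differentiable (Suc n) f \<Longrightarrow> times_cont_differentiable n f"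
proof (induction n arbitrary: f)
  case 0
  then show ?case
    by (auto intro!: differentiable_imp_continuous_on simp: differentiable_on_def
        intro: differentiable_at_withinI)
next
  case (Suc n)
  then show ?case by (metis times_cont_differentiable.simps(2))
qed

lemma times_cont_differentiable_const: "times_cont_differentiable n (\<lambda>a. c)"
  by (induction n arbitrary: c) auto

lemma times_cont_differentiable_linear:
  assumes "bounded_linear h" "times_cont_differentiable n f"
  shows "times_cont_differentiable n (\<lambda>a. h (f a))"
  using assms(2)
proof (induction n arbitrary: f)
  case 0
  then show ?case
    using linear_continuous_on[OF assms(1)] by (auto intro: continuous_on_compose2)
next
  case (Suc n)
  have "((\<lambda>a. h (f a)) has_derivative (\<lambda>v. h (dirderiv v f a))) (at a)" for a
    using Suc.prems frechet_derivative_works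
    by (intro bounded_linear.has_derivative[OF assms(1)]) auto
  then show ?case
    using Suc by (intro times_cont_differentiable_SucI) auto
qed

lemma times_cont_differentiable_add:
  assumes "times_cont_differentiable n f" "times_cont_differentiable n g"
  shows "times_cont_differentiable n (\<lambda>a. f a + g a)"
  using assms
proof (induction n arbitrary: f g)
  case 0
  then show ?case by (auto intro: continuous_on_add)
next
  case (Suc n)
  have "((\<lambda>a. f a + g a) has_derivative (\<lambda>v. dirderiv v f a + dirderiv v g a)) (at a)" for a
    using Suc.prems frechet_derivative_works by (intro has_derivative_add) auto
  then show ?case
    using Suc by (intro times_cont_differentiable_SucI) auto
qed

lemma times_cont_differentiable_bilinear:
  assumes "bounded_bilinear h" "times_cont_differentiable n f" "times_cont_differentiable n g"
  shows "times_cont_differentiable n (\<lambda>a. h (f a) (g a))"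
  using assms(2,3)
proof (induction n arbitrary: f g)
  case 0
  then show ?case
    using bounded_bilinear.continuous_on[OF assms(1)] by auto
next
  case (Suc n)
  have "((\<lambda>a. h (f a) (g a)) has_derivative
      (\<lambda>v. h (f a) (dirderiv v g a) + h (dirderiv v f a) (g a))) (at a)" for a
    using Suc.prems by (intro bounded_bilinear.FDERIV[OF assms(1)])
      (auto simp flip: frechet_derivative_works)
  moreover have "times_cont_differentiable n f" "times_cont_differentiable n g"
    using Suc.prems times_cont_differentiable_Suc_lower by auto
  ultimately show ?case
    using Suc by (intro times_cont_differentiable_SucI) (auto intro!: times_cont_differentiable_add)
qed

lemma smooth_has_derivative:
  "smooth f \<Longrightarrow> (f has_derivative (\<lambda>v. dirderiv v f a)) (at a)"
  unfolding smooth_def using frechet_derivative_works times_cont_differentiable.simps(2) by blast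

lemma smooth_dirderiv [intro]: "smooth f \<Longrightarrow> smooth (\<lambda>a. dirderiv v f a)"
  unfolding smooth_def using times_cont_differentiable.simps(2) by blast

lemma smooth_continuous: "smooth f \<Longrightarrow> continuous_on A f"
  unfolding smooth_def using times_cont_differentiable.simps(1) continuous_on_subset subset_UNIV
  by metis

lemma smooth_const [intro]: "smooth (\<lambda>a. c)"
  by (simp add: smooth_def times_cont_differentiable_const)

lemma smooth_ident [intro]: "smooth (\<lambda>a. a)"
  unfolding smooth_def
proof
  fix n show "times_cont_differentiable n (\<lambda>a::'a. a)"
    by (cases n) (auto simp: times_cont_differentiable_const continuous_on_id)
qed

lemma smooth_linear: "bounded_linear h \<Longrightarrow> smooth f \<Longrightarrow> smooth (\<lambda>a. h (f a))"
  by (simp add: smooth_def times_cont_differentiable_linear)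

lemma smooth_bilinear: "bounded_bilinear h \<Longrightarrow> smooth f \<Longrightarrow> smooth g \<Longrightarrow> smooth (\<lambda>a. h (f a) (g a))"
  by (simp add: smooth_def times_cont_differentiable_bilinear)

lemma smooth_add [intro]: "smooth f \<Longrightarrow> smooth g \<Longrightarrow> smooth (\<lambda>a. f a + g a)"
  by (simp add: smooth_def times_cont_differentiable_add)

lemma smooth_minus [intro]: "smooth f \<Longrightarrow> smooth (\<lambda>a. - f a)"
  by (rule smooth_linear[OF bounded_linear_minus[OF bounded_linear_ident]])

lemma smooth_diff [intro]: "smooth f \<Longrightarrow> smooth g \<Longrightarrow> smooth (\<lambda>a. f a - g a)"
  using smooth_add[OF _ smooth_minus, of f g] by simp

lemmas smooth_scaleR [intro] = smooth_bilinear[OF bounded_bilinear_scaleR]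
lemmas smooth_inner [intro] = smooth_bilinear[OF bounded_bilinear_inner]
lemmas smooth_mult [intro] = smooth_bilinear[OF bounded_bilinear_mult]
lemmas smooth_cnj [intro] = smooth_linear[OF bounded_linear_cnj]
lemmas smooth_Re [intro] = smooth_linear[OF bounded_linear_Re]
lemmas smooth_of_real [intro] = smooth_linear[OF bounded_linear_of_real]
lemmas smooth_nth [intro] = smooth_linear[OF bounded_linear_vec_nth]

text \<open>This serves to glue fields that stabilize on larger and larger balls; the members of such a sequence
  are smooth on the whole space, whence the form of the hypothesis.\<close>

lemma smooth_locally:
  assumes "\<And>a. \<exists>g U. smooth g \<and> open U \<and> a \<in> U \<and> (\<forall>x\<in>U. f x = g x)"
  shows "smooth f"
proof -
  have "times_cont_differentiable n f"
    if "\<And>a. \<exists>g U. smooth g \<and> open U \<and> a \<in> U \<and> (\<forall>x\<in>U. f x = g x)"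
    for n and f :: "'a \<Rightarrow> 'b"
    using that
  proof (induction n arbitrary: f)
    case 0
    have "isCont f a" for a
    proof -
      obtain g U where g: "smooth g" "open U" "a \<in> U" "\<forall>x\<in>U. f x = g x" using 0 by meson
      have "isCont g a"
        using smooth_continuous[OF g(1), of UNIV] by (simp add: continuous_on_eq_continuous_at)
      moreover have "eventually (\<lambda>x. f x = g x) (nhds a)"
        using g eventually_nhds by blast
      ultimately show ?thesis using isCont_cong by blast
    qed
    then show ?case by (simp add: continuous_at_imp_continuous_on)
  next
    case (Suc n)
    have der: "\<exists>g U. smooth g \<and> open U \<and> a \<in> U \<and>
        (\<forall>x\<in>U. (f has_derivative (\<lambda>v. dirderiv v g x)) (at x))" for a
    proof -
      obtain g U where g: "smooth g" "open U" "a \<in> U" "\<forall>x\<in>U. f x = g x" using Suc.prems by meson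
      have "(f has_derivative (\<lambda>v. dirderiv v g x)) (at x)" if "x \<in> U" for x
        by (rule has_derivative_transform_within_open[OF smooth_has_derivative[OF g(1)] g(2) that])
           (use g(4) in auto)
      then show ?thesis using g by blast
    qed
    have "f differentiable (at a)" for a
      using der[of a] differentiable_def by blast
    moreover have "times_cont_differentiable n (\<lambda>a. dirderiv v f a)" for v
    proof (rule Suc.IH)
      fix a
      obtain g U where g: "smooth g" "open U" "a \<in> U"
        "\<forall>x\<in>U. (f has_derivative (\<lambda>v. dirderiv v g x)) (at x)" using der[of a] by meson
      have "\<forall>x\<in>U. dirderiv v f x = dirderiv v g x"
        using g(4) frechet_derivative_at by metis
      then show "\<exists>h U. smooth h \<and> open U \<and> a \<in> U \<and> (\<forall>x\<in>U. dirderiv v f x = h x)"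
        using g smooth_dirderiv by blast
    qed
    ultimately show ?case by simp
  qed
  then show ?thesis using assms by (simp add: smooth_def)
qed

lemma times_cont_differentiable_sum:
  "(\<And>i. i \<in> I \<Longrightarrow> times_cont_differentiable n (f i)) \<Longrightarrow> times_cont_differentiable n (\<lambda>a. \<Sum>i\<in>I. f i a)"
  by (induction I rule: infinite_finite_induct) (auto simp: times_cont_differentiable_const times_cont_differentiable_add)

text \<open>Expanding the inner derivative in a basis turns the chain rule into a finite sum of products of a
  derivative of \<open>f\<close> with a derivative of \<open>g\<close> composed with \<open>f\<close>; the induction on the order of
  differentiability must therefore run over all \<open>g\<close> at once.\<close>

lemma smooth_compose:
  fixes g :: "'b::euclidean_space \<Rightarrow> 'c::real_normed_vector"
  assumes "smooth g" "smooth f"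
  shows "smooth (\<lambda>a. g (f a))"
proof -
  have "times_cont_differentiable n (\<lambda>a. g (f a))" if "smooth g" for n and g :: "'b \<Rightarrow> 'c"
    using that
  proof (induction n arbitrary: g)
    case 0
    then show ?case
      using smooth_continuous[OF assms(2)] smooth_continuous[OF 0]
      by (auto intro: continuous_on_compose2)
  next
    case (Suc n)
    have "((\<lambda>a. g (f a)) has_derivative
       (\<lambda>v. \<Sum>b\<in>Basis. (dirderiv v f a \<bullet> b) *\<^sub>R dirderiv b g (f a))) (at a)" for a
    proof -
      have "((\<lambda>a. g (f a)) has_derivative (\<lambda>v. dirderiv (dirderiv v f a) g (f a))) (at a)"
        using has_derivative_compose[OF smooth_has_derivative[OF assms(2)]
            smooth_has_derivative[OF Suc.prems]] .
      moreover have "dirderiv w g (f a) = (\<Sum>b\<in>Basis. (w \<bullet> b) *\<^sub>R dirderiv b g (f a))" for w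
      proof -
        have "linear (\<lambda>v. dirderiv v g (f a))"
          using smooth_has_derivative[OF Suc.prems] has_derivative_linear by blast
        from linear_sum[OF this, of "\<lambda>b. (w \<bullet> b) *\<^sub>R b" Basis] linear_scale[OF this]
        show ?thesis by (simp add: euclidean_representation)
      qed
      ultimately show ?thesis by (elim has_derivative_eq_rhs) blast
    qed
    moreover have "times_cont_differentiable n (\<lambda>a. dirderiv v f a \<bullet> b)" for v b
      using smooth_inner[OF smooth_dirderiv[OF assms(2)] smooth_const] smooth_def by blast
    ultimately show ?case
      using Suc.IH[OF smooth_dirderiv[OF Suc.prems]]
      by (intro times_cont_differentiable_SucI) (auto intro!: times_cont_differentiable_sum times_cont_differentiable_bilinear[OF bounded_bilinear_scaleR])
  qed
  then show ?thesis using assms(1) by (simp add: smooth_def)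
qed

text \<open>The exponent drops by one with each differentiation, so the induction runs over all exponents.
  The exponent \<open>-1\<close> gives reciprocals, and \<open>-1/2\<close> applied to an inner product gives normalization.\<close>

lemma smooth_powr:
  fixes f :: "'a::real_normed_vector \<Rightarrow> real"
  assumes "smooth f" "\<And>a. f a > 0"
  shows "smooth (\<lambda>a. f a powr c)"
proof -
  have "times_cont_differentiable n (\<lambda>a. f a powr c)" for n c
  proof (induction n arbitrary: c)
    case 0
    then show ?case
      using smooth_continuous[OF assms(1)] assms(2)
      by (auto intro!: continuous_on_powr continuous_on_const simp: less_imp_neq[symmetric])
  next
    case (Suc n)
    have "((\<lambda>a. f a powr c) has_derivative
       (\<lambda>v. (c *\<^sub>R (f a powr (c - 1))) * dirderiv v f a)) (at a)" for a
      using has_derivative_powr[OF smooth_has_derivative[OF assms(1), of a]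
          has_derivative_const[of c] assms(2) UNIV_I] assms(2)[of a]
      by (simp add: powr_diff mult_ac)
    moreover have "times_cont_differentiable n (\<lambda>a. dirderiv v f a)" for v
      using smooth_dirderiv[OF assms(1)] smooth_def by blast
    ultimately show ?case
      using Suc
      by (intro times_cont_differentiable_SucI[where f = "\<lambda>a. f a powr c"]) (auto intro!: times_cont_differentiable_bilinear[OF bounded_bilinear_mult] times_cont_differentiable_const)
  qed
  then show ?thesis by (simp add: smooth_def)
qed

section \<open>Smooth truncations of a Euclidean space\<close>

text \<open>These are the functions \<open>exp (- 1 / x) / x ^ k\<close>, extended by zero to \<open>x \<le> 0\<close>. The whole family is needed
  because the derivative of one member is a combination of two others.\<close>

definition flat :: "nat \<Rightarrow> real \<Rightarrow> real" where
  "flat k x = (if x > 0 then exp (- (1 / x)) / x ^ k else 0)"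

lemma flat_has_derivative:
  "(flat k has_derivative (\<lambda>v. v * (flat (k + 2) x - real k * flat (k + 1) x))) (at x)"
proof -
  consider "x < 0" | "x = 0" | "x > 0" by linarith
  then have "(flat k has_real_derivative (flat (k + 2) x - real k * flat (k + 1) x)) (at x)"
  proof cases
    case 1
    have "((\<lambda>x. 0) has_real_derivative 0) (at x)" by simp
    then have "(flat k has_real_derivative 0) (at x)"
      by (rule has_field_derivative_transform_within_open[where S="{..<0}"])
        (use 1 in \<open>auto simp: flat_def\<close>)
    then show ?thesis using 1 by (simp add: flat_def)
  next
    case 2
    have "((\<lambda>h::real. exp (- (1 / h)) / h ^ k / h) \<longlongrightarrow> 0) (at_right 0)"
      by real_asymp
    then have "((\<lambda>h. flat k h / h) \<longlongrightarrow> 0) (at_right 0)"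
      by (rule Lim_transform_eventually)
        (auto simp: flat_def eventually_at_right_field intro: exI[of _ 1])
    moreover have "((\<lambda>h::real. 0) \<longlongrightarrow> (0::real)) (at_left 0)" by simp
    then have "((\<lambda>h. flat k h / h) \<longlongrightarrow> 0) (at_left 0)"
      by (rule Lim_transform_eventually)
        (auto simp: flat_def eventually_at_left_field intro: exI[of _ "-1"])
    ultimately have "((\<lambda>h. flat k h / h) \<longlongrightarrow> 0) (at 0)"
      using filterlim_split_at by blast
    then show ?thesis using 2 by (simp add: DERIV_def flat_def)
  next
    case 3
    have "((\<lambda>x. exp (- (1 / x))) has_real_derivative exp (- (1 / x)) * (1 / x\<^sup>2)) (at x)"
      using 3 by (auto intro!: derivative_eq_intros simp: power2_eq_square)
    from DERIV_divide[OF this DERIV_pow[of k x]] 3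
    have "((\<lambda>x. exp (- (1 / x)) / x ^ k) has_real_derivative
        (exp (- (1 / x)) * (1 / x\<^sup>2) * x ^ k - exp (- (1 / x)) * (real k * x ^ (k - Suc 0)))
          / (x ^ k * x ^ k)) (at x)"
      by simp
    also have "(exp (- (1 / x)) * (1 / x\<^sup>2) * x ^ k - exp (- (1 / x)) * (real k * x ^ (k - Suc 0)))
          / (x ^ k * x ^ k) = flat (k + 2) x - real k * flat (k + 1) x"
      using 3 by (cases k) (simp_all add: flat_def field_simps power2_eq_square)
    finally have "((\<lambda>x. exp (- (1 / x)) / x ^ k) has_real_derivative
        (flat (k + 2) x - real k * flat (k + 1) x)) (at x)" .
    then show ?thesis
      by (rule has_field_derivative_transform_within_open[where S="{0<..}"])
        (use 3 in \<open>auto simp: flat_def\<close>)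
  qed
  then show ?thesis by (simp add: has_field_derivative_def mult.commute[of _ "_ - _"])
qed

lemma smooth_flat: "smooth (flat k)"
proof -
  have "times_cont_differentiable n (flat k)" for n k
  proof (induction n arbitrary: k)
    case 0
    have "isCont (flat k) x" for x
      using flat_has_derivative has_derivative_continuous by blast
    then show ?case by (simp add: continuous_at_imp_continuous_on)
  next
    case (Suc n)
    have "times_cont_differentiable n (\<lambda>x. v *\<^sub>R (flat (k + 2) x + (- real k) *\<^sub>R flat (k + 1) x))" for v
      by (intro times_cont_differentiable_add times_cont_differentiable_linear[OF bounded_linear_scaleR_right] Suc)
    then have "times_cont_differentiable n (\<lambda>x. v * (flat (k + 2) x - real k * flat (k + 1) x))" for v
      by simp
    then show ?case by (rule times_cont_differentiable_SucI[OF flat_has_derivative])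
  qed
  then show ?thesis by (simp add: smooth_def)
qed

text \<open>The map divides \<open>a\<close> by a denominator that is \<open>1\<close> on the ball of radius \<open>R\<close> and grows quadratically
  outside it. It serves to replace a field on the whole space by one that only sees the values on a
  bounded set and is unchanged on the ball.\<close>

lemma exists_smooth_truncation:
  fixes R :: real
  assumes "R \<ge> 0"
  obtains \<rho> :: "'a::euclidean_space \<Rightarrow> 'a"
  where "smooth \<rho>" "bounded (range \<rho>)" "\<And>a. norm a \<le> R \<Longrightarrow> \<rho> a = a"
proof
  define x where "x a = a \<bullet> a - R\<^sup>2" for a :: 'a
  define m where "m a = 1 + flat 0 (x a) * (a \<bullet> a)" for a :: 'a
  have flat0: "0 \<le> flat 0 y" for y by (simp add: flat_def)
  have m: "m a \<ge> 1" for a by (simp add: m_def flat0)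
  have inv: "m a powr - 1 = 1 / m a" for a
    using m[of a] by (simp add: powr_minus divide_inverse)
  show "smooth (\<lambda>a. (m a powr - 1) *\<^sub>R a)"
  proof -
    have "smooth (\<lambda>a. flat 0 (x a))"
      unfolding x_def by (rule smooth_compose[OF smooth_flat]) (intro smooth_diff smooth_inner smooth_ident smooth_const)
    then have "smooth m" unfolding m_def by (intro smooth_add smooth_mult smooth_inner smooth_ident smooth_const)
    then show ?thesis
      using m by (intro smooth_scaleR smooth_powr smooth_ident) (auto intro: less_le_trans[OF zero_less_one])
  qed
  show "(m a powr - 1) *\<^sub>R a = a" if "norm a \<le> R" for a
  proof -
    have "(norm a)\<^sup>2 \<le> R\<^sup>2"
      using that by (intro power_mono) auto
    then have "x a \<le> 0" by (simp add: x_def power2_norm_eq_inner)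
    then have "flat 0 (x a) = 0" by (simp only: flat_def not_less[symmetric] if_False)
    then have "m a = 1" by (simp add: m_def)
    then show ?thesis by (simp add: inv)
  qed
  \<comment> \<open>Beyond radius \<open>1 + R\<close> the argument of \<open>flat 0\<close> exceeds \<open>1\<close>, hence \<open>m a \<ge> exp (-1) * norm a\<close>.\<close>
  have "norm ((m a powr - 1) *\<^sub>R a) \<le> (1 + R) + exp 1" for a
  proof -
    have "norm a \<le> (1 + R + exp 1) * m a"
    proof (cases "norm a \<le> 1 + R")
      case True
      then have "norm a \<le> (1 + R + exp 1) * 1" by (simp add: add_increasing2)
      also have "\<dots> \<le> (1 + R + exp 1) * m a"
        using assms m by (intro mult_left_mono) auto
      finally show ?thesis .
    next
      case False
      then have "(1 + R)\<^sup>2 \<le> (norm a)\<^sup>2" using assms by (intro power_mono) auto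
      moreover have "(1 + R)\<^sup>2 \<ge> 1 + R\<^sup>2" using assms by (simp add: power2_eq_square algebra_simps)
      ultimately have x: "1 \<le> x a" by (simp add: x_def power2_norm_eq_inner)
      then have "exp (- 1) \<le> flat 0 (x a)" by (simp add: flat_def)
      moreover have "norm a \<le> a \<bullet> a"
        using False assms self_le_power[of "norm a" 2] by (simp add: power2_norm_eq_inner)
      ultimately have "exp (- 1) * norm a \<le> flat 0 (x a) * (a \<bullet> a)"
        by (intro mult_mono) (auto simp: flat0)
      then have "exp 1 * (exp (- 1) * norm a) \<le> exp 1 * m a"
        by (intro mult_left_mono) (auto simp: m_def)
      moreover have "exp 1 * (exp (- 1) * norm a) = norm a"
        by (simp add: exp_minus)
      ultimately have "norm a \<le> exp 1 * m a" by linarith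
      also have "\<dots> \<le> (1 + R + exp 1) * m a"
        using assms m[of a] by (intro mult_right_mono) auto
      finally show ?thesis .
    qed
    then show ?thesis using m[of a] by (simp add: inv pos_divide_le_eq)
  qed
  then show "bounded (range (\<lambda>a. (m a powr - 1) *\<^sub>R a))"
    unfolding bounded_iff by blast
qed

section \<open>Symmetry of second derivatives\<close>

text \<open>The second difference is symmetric in \<open>u\<close> and \<open>v\<close>, and two applications of the mean value
  theorem, first along \<open>u\<close> and then along \<open>v\<close>, turn it into a mixed second derivative at an
  intermediate point.\<close>

lemma second_difference_mean_value:
  fixes f :: "'a::real_normed_vector \<Rightarrow> real"
  assumes "smooth f" "h > 0"
  obtains s t where "0 < s" "s < h" "0 < t" "t < h"
    "f (a + h *\<^sub>R u + h *\<^sub>R v) - f (a + h *\<^sub>R u) - f (a + h *\<^sub>R v) + f a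
       = h\<^sup>2 * dirderiv v (\<lambda>a. dirderiv u f a) (a + s *\<^sub>R u + t *\<^sub>R v)"
proof -
  have line: "((\<lambda>s. g (b + s *\<^sub>R w)) has_real_derivative dirderiv w g (b + s *\<^sub>R w)) (at s)"
    if "smooth g" for g :: "'a \<Rightarrow> real" and b w s
  proof -
    have "((\<lambda>s. b + s *\<^sub>R w) has_derivative (\<lambda>k. k *\<^sub>R w)) (at s)"
      by (auto intro!: derivative_eq_intros)
    from has_derivative_compose[OF this smooth_has_derivative[OF that]]
    have "((\<lambda>s. g (b + s *\<^sub>R w)) has_derivative (\<lambda>k. dirderiv (k *\<^sub>R w) g (b + s *\<^sub>R w))) (at s)" .
    moreover have "dirderiv (k *\<^sub>R w) g c = k * dirderiv w g c" for k c
      using linear_scale[OF has_derivative_linear[OF smooth_has_derivative[OF that]]] by simp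
    ultimately show ?thesis
      by (auto simp: has_field_derivative_def mult.commute elim!: has_derivative_eq_rhs)
  qed
  let ?\<phi> = "\<lambda>s. f (a + h *\<^sub>R v + s *\<^sub>R u) - f (a + s *\<^sub>R u)"
  have "\<exists>s. 0 < s \<and> s < h \<and>
      ?\<phi> h - ?\<phi> 0 = (h - 0) * (dirderiv u f (a + h *\<^sub>R v + s *\<^sub>R u) - dirderiv u f (a + s *\<^sub>R u))"
    by (rule MVT2[OF assms(2)]) (auto intro!: DERIV_diff line assms(1))
  then obtain s where s: "0 < s" "s < h"
    "?\<phi> h - ?\<phi> 0 = h * (dirderiv u f (a + h *\<^sub>R v + s *\<^sub>R u) - dirderiv u f (a + s *\<^sub>R u))"
    by auto
  let ?\<psi> = "\<lambda>t. dirderiv u f (a + s *\<^sub>R u + t *\<^sub>R v)"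
  have "\<exists>t. 0 < t \<and> t < h \<and> ?\<psi> h - ?\<psi> 0 =
      (h - 0) * dirderiv v (\<lambda>a. dirderiv u f a) (a + s *\<^sub>R u + t *\<^sub>R v)"
    by (rule MVT2[OF assms(2)]) (intro line smooth_dirderiv assms(1))
  then obtain t where t: "0 < t" "t < h"
    "?\<psi> h - ?\<psi> 0 = h * dirderiv v (\<lambda>a. dirderiv u f a) (a + s *\<^sub>R u + t *\<^sub>R v)" by auto
  have "?\<phi> h - ?\<phi> 0 = h * (?\<psi> h - ?\<psi> 0)"
    using s(3) by (simp add: add_ac)
  then show ?thesis
    using that[OF s(1,2) t(1,2)] t(3) by (simp add: power2_eq_square add_ac)
qed

lemma dirderiv_commute_real:
  fixes f :: "'a::real_normed_vector \<Rightarrow> real"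
  assumes "smooth f"
  shows "dirderiv v (\<lambda>a. dirderiv u f a) a = dirderiv u (\<lambda>a. dirderiv v f a) a"
proof -
  define A where "A = (\<lambda>a. dirderiv v (\<lambda>a. dirderiv u f a) a)"
  define B where "B = (\<lambda>a. dirderiv u (\<lambda>a. dirderiv v f a) a)"
  define h where "h = (\<lambda>n. inverse (real (Suc n)))"
  have h: "h \<longlonglongrightarrow> 0" "h n > 0" for n
    unfolding h_def by (rule LIMSEQ_inverse_real_of_nat, simp)
  \<comment> \<open>The two orders of differentiation give the same second difference with side \<open>h n\<close>.\<close>
  have "\<exists>s t s' t'. 0 < s \<and> s < h n \<and> 0 < t \<and> t < h n \<and> 0 < s' \<and> s' < h n \<and> 0 < t' \<and> t' < h n \<and>
     A (a + s *\<^sub>R u + t *\<^sub>R v) = B (a + s' *\<^sub>R v + t' *\<^sub>R u)" for n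
  proof -
    obtain s t where st: "0 < s" "s < h n" "0 < t" "t < h n"
      "f (a + h n *\<^sub>R u + h n *\<^sub>R v) - f (a + h n *\<^sub>R u) - f (a + h n *\<^sub>R v) + f a
       = (h n)\<^sup>2 * A (a + s *\<^sub>R u + t *\<^sub>R v)"
      unfolding A_def by (rule second_difference_mean_value[OF assms h(2)])
    obtain s' t' where st': "0 < s'" "s' < h n" "0 < t'" "t' < h n"
      "f (a + h n *\<^sub>R v + h n *\<^sub>R u) - f (a + h n *\<^sub>R v) - f (a + h n *\<^sub>R u) + f a
       = (h n)\<^sup>2 * B (a + s' *\<^sub>R v + t' *\<^sub>R u)"
      unfolding B_def by (rule second_difference_mean_value[OF assms h(2)])
    have "(h n)\<^sup>2 * A (a + s *\<^sub>R u + t *\<^sub>R v) = (h n)\<^sup>2 * B (a + s' *\<^sub>R v + t' *\<^sub>R u)"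
      using st(5) st'(5) by (simp add: add.commute add.left_commute algebra_simps del: mult_cancel_left)
    then have "A (a + s *\<^sub>R u + t *\<^sub>R v) = B (a + s' *\<^sub>R v + t' *\<^sub>R u)"
      using h(2)[of n] by simp
    then show ?thesis using st st' by blast
  qed
  then obtain s t s' t' where *: "\<And>n. 0 < s n \<and> s n < h n \<and> 0 < t n \<and> t n < h n \<and> 0 < s' n \<and> s' n < h n
     \<and> 0 < t' n \<and> t' n < h n \<and> A (a + s n *\<^sub>R u + t n *\<^sub>R v) = B (a + s' n *\<^sub>R v + t' n *\<^sub>R u)"
    by metis
  have sq: "x \<longlonglongrightarrow> 0" if "\<And>n. 0 < x n \<and> x n < h n" for x :: "nat \<Rightarrow> real"
    by (rule tendsto_sandwich[OF _ _ tendsto_const h(1)])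
       (use that in \<open>auto intro!: always_eventually less_imp_le\<close>)
  have "s \<longlonglongrightarrow> 0" "t \<longlonglongrightarrow> 0" "s' \<longlonglongrightarrow> 0" "t' \<longlonglongrightarrow> 0"
    using * by (auto intro: sq)
  then have lim: "(\<lambda>n. a + s n *\<^sub>R u + t n *\<^sub>R v) \<longlonglongrightarrow> a + 0 *\<^sub>R u + 0 *\<^sub>R v"
    "(\<lambda>n. a + s' n *\<^sub>R v + t' n *\<^sub>R u) \<longlonglongrightarrow> a + 0 *\<^sub>R v + 0 *\<^sub>R u"
    by - (intro tendsto_add tendsto_scaleR tendsto_const; assumption)+
  have "isCont A a" "isCont B a"
    using smooth_continuous[of A UNIV] smooth_continuous[of B UNIV] assms
    by (auto simp: A_def B_def smooth_dirderiv continuous_on_eq_continuous_at)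
  then have "(\<lambda>n. A (a + s n *\<^sub>R u + t n *\<^sub>R v)) \<longlonglongrightarrow> A a"
    "(\<lambda>n. B (a + s' n *\<^sub>R v + t' n *\<^sub>R u)) \<longlonglongrightarrow> B a"
    using lim by (auto intro: isCont_tendsto_compose)
  moreover have "(\<lambda>n. A (a + s n *\<^sub>R u + t n *\<^sub>R v)) = (\<lambda>n. B (a + s' n *\<^sub>R v + t' n *\<^sub>R u))"
    using * by auto
  ultimately have "A a = B a" using LIMSEQ_unique by metis
  then show ?thesis by (simp add: A_def B_def)
qed

lemma dirderiv_linear:
  assumes "bounded_linear h" "smooth f"
  shows "dirderiv v (\<lambda>a. h (f a)) a = h (dirderiv v f a)"
  using frechet_derivative_at[OF bounded_linear.has_derivative[OF assms(1) smooth_has_derivative[OF assms(2)]]]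
  by metis

text \<open>Taking inner products with a fixed vector reduces the claim to real-valued functions.\<close>

lemma dirderiv_commute:
  fixes f :: "'a::real_normed_vector \<Rightarrow> 'b::real_inner"
  assumes "smooth f"
  shows "dirderiv v (\<lambda>a. dirderiv u f a) a = dirderiv u (\<lambda>a. dirderiv v f a) a"
proof -
  have "dirderiv v (\<lambda>a. dirderiv u f a) a \<bullet> w = dirderiv u (\<lambda>a. dirderiv v f a) a \<bullet> w" for w
    using dirderiv_commute_real[OF smooth_inner[OF assms smooth_const[of w]]]
    by (simp add: dirderiv_linear[OF bounded_linear_inner_left] assms smooth_dirderiv)
  then show ?thesis by (metis vector_eq_rdot)
qed

section \<open>Smooth eigenvector fields of matrix involutions\<close>

lemma bounded_bilinear_matrix_vector_mult:
  "bounded_bilinear ((*v) :: cmat2 \<Rightarrow> complex^2 \<Rightarrow> complex^2)"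
proof -
  have "bilinear ((*v) :: cmat2 \<Rightarrow> complex^2 \<Rightarrow> complex^2)"
    unfolding bilinear_def
    by (auto intro!: linearI simp: vec_eq_iff matrix_vector_mult_def algebra_simps sum.distrib
        scaleR_sum_right)
  then show ?thesis by (simp add: bilinear_conv_bounded_bilinear)
qed

lemma matrix_vector_mult_sgn:
  fixes A :: cmat2
  assumes "A *v x = - x"
  shows "A *v sgn x = - sgn x"
  using bounded_bilinear.scaleR_right[OF bounded_bilinear_matrix_vector_mult, of A] assms
  by (simp add: sgn_div_norm)

lemma smooth_sgn:
  fixes f :: "'a::real_normed_vector \<Rightarrow> 'b::real_inner"
  assumes "smooth f" "\<And>a. f a \<noteq> 0"
  shows "smooth (\<lambda>a. sgn (f a))"
proof -
  have "sgn x = ((x \<bullet> x) powr (- (1 / 2))) *\<^sub>R x" for x :: 'b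
    by (simp add: sgn_div_norm powr_minus powr_half_sqrt norm_eq_sqrt_inner)
  moreover have "smooth (\<lambda>a. ((f a \<bullet> f a) powr (- (1 / 2))) *\<^sub>R f a)"
    using assms by (intro smooth_scaleR smooth_powr smooth_inner) auto
  ultimately show ?thesis by simp
qed

text \<open>The first column of a unitary matrix that diagonalizes \<open>S\<close>, with the eigenvalue \<open>-1\<close> in the
  first place, is such a field.\<close>

definition unit_eigenfield ::
  "('a::real_normed_vector \<Rightarrow> cmat2) \<Rightarrow> ('a \<Rightarrow> complex^2) \<Rightarrow> bool" where
  "unit_eigenfield S \<psi> \<longleftrightarrow> smooth \<psi> \<and> (\<forall>a. norm (\<psi> a) = 1 \<and> S a *v \<psi> a = - \<psi> a)"

text \<open>If \<open>T\<close> is an involution, \<open>x - T x\<close> always lies in its eigenspace for \<open>-1\<close>. For \<open>T\<close> close to \<open>S\<close>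
  this vector is close to \<open>2 x\<close> when \<open>x\<close> is in the eigenspace of \<open>S\<close>, hence does not vanish and
  can be normalized. Where \<open>T = S\<close> the eigenvector is recovered unchanged; this is what makes
  gluing possible later.\<close>

lemma unit_eigenfield_perturb:
  assumes "unit_eigenfield S \<psi>" and "smooth T" and inv: "\<And>a. T a ** T a = mat 1"
    and close: "\<And>a x. norm x = 1 \<Longrightarrow> norm ((T a - S a) *v x) < 2"
  obtains \<phi> where "unit_eigenfield T \<phi>" "\<And>a. T a = S a \<Longrightarrow> \<phi> a = \<psi> a"
proof
  define \<xi> where "\<xi> a = \<psi> a - T a *v \<psi> a" for a
  have \<psi>: "smooth \<psi>" "norm (\<psi> a) = 1" "S a *v \<psi> a = - \<psi> a" for a
    using assms(1) by (auto simp: unit_eigenfield_def)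
  have "\<xi> a \<noteq> 0" for a
  proof
    assume "\<xi> a = 0"
    then have "(T a - S a) *v \<psi> a = 2 *\<^sub>R \<psi> a"
      using \<psi>(3)[of a] by (simp add: \<xi>_def matrix_vector_mult_diff_rdistrib scaleR_2)
    then show False using close[OF \<psi>(2)[of a], of a] \<psi>(2)[of a] by simp
  qed
  moreover have "smooth \<xi>"
    unfolding \<xi>_def by (intro smooth_diff smooth_bilinear[OF bounded_bilinear_matrix_vector_mult] \<psi> assms)
  moreover have "T a *v \<xi> a = - \<xi> a" for a
    by (simp add: \<xi>_def matrix_vector_mult_diff_distrib matrix_vector_mul_assoc inv)
  then have "T a *v sgn (\<xi> a) = - sgn (\<xi> a)" for a
    by (rule matrix_vector_mult_sgn)
  ultimately show "unit_eigenfield T (\<lambda>a. sgn (\<xi> a))"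
    by (simp add: unit_eigenfield_def smooth_sgn norm_sgn)
  show "sgn (\<xi> a) = \<psi> a" if "T a = S a" for a
    using that \<psi>(2)[of a] \<psi>(3)[of a]
    by (simp add: \<xi>_def sgn_div_norm flip: scaleR_2)
qed

text \<open>Bounded ranges make \<open>S\<close> uniformly continuous along the straight-line homotopy from \<open>f\<close> to \<open>g\<close>, so
  that finitely many steps, the same number for all points, are each short enough for
  \<open>unit_eigenfield_perturb\<close>. Points with \<open>f a = g a\<close> stay fixed during the homotopy.\<close>

lemma unit_eigenfield_homotopy:
  fixes S :: "'a::euclidean_space \<Rightarrow> cmat2" and f g :: "'b::real_normed_vector \<Rightarrow> 'a"
  assumes "smooth S" and inv: "\<And>a. S a ** S a = mat 1"
    and f: "smooth f" "bounded (range f)" and g: "smooth g" "bounded (range g)"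
    and \<psi>: "unit_eigenfield (\<lambda>a. S (f a)) \<psi>"
  obtains \<phi> where "unit_eigenfield (\<lambda>a. S (g a)) \<phi>" "\<And>a. f a = g a \<Longrightarrow> \<phi> a = \<psi> a"
proof -
  obtain K where K: "K > 0" "\<And>(A::cmat2) (x::complex^2). norm (A *v x) \<le> norm A * norm x * K"
    using bounded_bilinear.pos_bounded[OF bounded_bilinear_matrix_vector_mult] by blast
  obtain B where "B > 0" "\<forall>x\<in>range f \<union> range g. norm x \<le> B"
    using f(2) g(2) bounded_pos[of "range f \<union> range g"] by auto
  then have B: "B > 0" "f a \<in> cball 0 B" "g a \<in> cball 0 B" for a
    by auto
  have "uniformly_continuous_on (cball 0 B) S"
    using compact_uniformly_continuous smooth_continuous[OF assms(1)] compact_cball by blast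
  then obtain d where d: "d > 0"
    "\<And>x y. \<lbrakk>x \<in> cball 0 B; y \<in> cball 0 B; dist y x < d\<rbrakk> \<Longrightarrow> dist (S y) (S x) < 2 / K"
    unfolding uniformly_continuous_on_def using K(1) by (metis divide_pos_pos zero_less_numeral)
  obtain N where N: "2 * B / d < real N" using reals_Archimedean2 by blast
  then have "real N > 0" using B(1) d(1) by (smt (verit) divide_pos_pos)
  \<comment> \<open>\<open>N\<close> exceeds \<open>2 * B / d\<close>, so that each of the \<open>N\<close> steps moves a point by less than \<open>d\<close>.\<close>
  define h where "h k a = f a + (real k / real N) *\<^sub>R (g a - f a)" for k a
  have hB: "h k a \<in> cball 0 B" if "k \<le> N" for k a
  proof -
    have "h k a = (1 - real k / real N) *\<^sub>R f a + (real k / real N) *\<^sub>R g a"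
      by (simp add: h_def algebra_simps)
    then show ?thesis
      using that \<open>real N > 0\<close> B(2,3) convexD[OF convex_cball, of "f a" 0 B "g a" "1 - real k / real N" "real k / real N"]
      by simp
  qed
  have "\<exists>\<phi>. unit_eigenfield (\<lambda>a. S (h k a)) \<phi> \<and> (\<forall>a. f a = g a \<longrightarrow> \<phi> a = \<psi> a)" if "k \<le> N" for k
    using that
  proof (induction k)
    case 0
    then show ?case using \<psi> by (auto simp: h_def)
  next
    case (Suc k)
    then obtain \<phi> where \<phi>: "unit_eigenfield (\<lambda>a. S (h k a)) \<phi>" "\<forall>a. f a = g a \<longrightarrow> \<phi> a = \<psi> a"
      by auto
    have "smooth (\<lambda>a. S (h (Suc k) a))"
      unfolding h_def
      by (rule smooth_compose[OF assms(1)])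
        (intro smooth_add smooth_scaleR smooth_diff smooth_const f g)
    moreover have "norm ((S (h (Suc k) a) - S (h k a)) *v x) < 2" if x: "norm x = 1" for a x
    proof -
      have "h (Suc k) a - h k a = (1 / real N) *\<^sub>R (g a - f a)"
        by (simp add: h_def add_divide_distrib algebra_simps)
      then have "dist (h (Suc k) a) (h k a) = norm (g a - f a) / real N"
        by (simp add: dist_norm)
      also have "norm (g a - f a) \<le> 2 * B"
        using norm_triangle_ineq4[of "g a" "f a"] B(2,3)[of a] by simp
      also have "2 * B / real N < d"
        using N d(1) \<open>real N > 0\<close> by (simp add: field_simps)
      finally have "dist (h (Suc k) a) (h k a) < d"
        using \<open>real N > 0\<close> by (simp add: divide_right_mono)
      then have "norm (S (h (Suc k) a) - S (h k a)) < 2 / K"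
        using d(2)[of "h k a" "h (Suc k) a"] hB Suc.prems by (simp add: dist_norm)
      then show ?thesis
        using K(1) K(2)[of "S (h (Suc k) a) - S (h k a)" x] x by (simp add: field_simps)
    qed
    ultimately obtain \<phi>' where "unit_eigenfield (\<lambda>a. S (h (Suc k) a)) \<phi>'"
      "\<And>a. S (h (Suc k) a) = S (h k a) \<Longrightarrow> \<phi>' a = \<phi> a"
      using unit_eigenfield_perturb[OF \<phi>(1), of "\<lambda>a. S (h (Suc k) a)"] inv by blast
    then show ?case using \<phi>(2) by (auto simp: h_def)
  qed
  then obtain \<phi> where "unit_eigenfield (\<lambda>a. S (h N a)) \<phi>" "\<And>a. f a = g a \<Longrightarrow> \<phi> a = \<psi> a" by blast
  moreover have "h N = g" using \<open>real N > 0\<close> by (auto simp: h_def)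
  ultimately show ?thesis using that by simp
qed

text \<open>The eigenspaces form a line bundle over a contractible space, so a global section is to be expected.
  It is built along truncations \<open>\<rho> n\<close> of the identity: starting from the constant section for the
  field frozen at the origin, a section for \<open>S \<circ> \<rho> n\<close> is deformed to one for \<open>S \<circ> \<rho> (n + 1)\<close>. As both
  truncations are the identity on the ball of radius \<open>n\<close>, nothing changes there any more, and the
  sequence is eventually constant near each point.\<close>

lemma exists_unit_eigenfield:
  fixes S :: "'a::euclidean_space \<Rightarrow> cmat2"
  assumes "smooth S" and inv: "\<And>a. S a ** S a = mat 1"
    and init: "norm v = 1" "S 0 *v v = - v"
  obtains \<psi> where "unit_eigenfield S \<psi>"
proof -
  have "\<exists>\<rho> :: 'a \<Rightarrow> 'a. smooth \<rho> \<and> bounded (range \<rho>) \<and> (\<forall>a. norm a \<le> real n \<longrightarrow> \<rho> a = a)" for n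
    using exists_smooth_truncation[of "real n"] by (metis of_nat_0_le_iff)
  then obtain \<rho> :: "nat \<Rightarrow> 'a \<Rightarrow> 'a" where \<rho>: "\<And>n. smooth (\<rho> n)" "\<And>n. bounded (range (\<rho> n))"
    "\<And>n a. norm a \<le> real n \<Longrightarrow> \<rho> n a = a"
    by metis
  have "\<exists>\<psi>. \<forall>n. unit_eigenfield (\<lambda>a. S (\<rho> n a)) (\<psi> n) \<and>
     (\<forall>a. \<rho> n a = \<rho> (Suc n) a \<longrightarrow> \<psi> (Suc n) a = \<psi> n a)"
  proof (rule dependent_nat_choice)
    have "unit_eigenfield (\<lambda>a. S 0) (\<lambda>a::'a. v)"
      using init by (simp add: unit_eigenfield_def smooth_const)
    then show "\<exists>\<psi>. unit_eigenfield (\<lambda>a. S (\<rho> 0 a)) \<psi>"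
      using unit_eigenfield_homotopy[OF assms(1) inv smooth_const _ \<rho>(1)[of 0] \<rho>(2)[of 0],
          of 0 "\<lambda>a. v"]
      by (auto simp: image_constant_conv)
  next
    fix \<psi> n
    assume "unit_eigenfield (\<lambda>a. S (\<rho> n a)) \<psi>"
    from unit_eigenfield_homotopy[OF assms(1) inv \<rho>(1,2) \<rho>(1,2) this, of "Suc n"]
    show "\<exists>\<phi>. unit_eigenfield (\<lambda>a. S (\<rho> (Suc n) a)) \<phi> \<and> (\<forall>a. \<rho> n a = \<rho> (Suc n) a \<longrightarrow> \<phi> a = \<psi> a)"
      by metis
  qed
  then obtain \<psi> where \<psi>: "\<And>n. unit_eigenfield (\<lambda>a. S (\<rho> n a)) (\<psi> n)"
    "\<And>n a. \<rho> n a = \<rho> (Suc n) a \<Longrightarrow> \<psi> (Suc n) a = \<psi> n a"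
    by metis
  have stable: "\<psi> m a = \<psi> n a" if "norm a \<le> real n" "n \<le> m" for m n a
    using that(2)
  proof (induction m rule: dec_induct)
    case (step m)
    then have "norm a \<le> real m" using that(1) by simp
    then show ?case using step \<psi>(2)[of m a] \<rho>(3)[of a m] \<rho>(3)[of a "Suc m"] by simp
  qed simp
  define \<Psi> where "\<Psi> a = \<psi> (nat \<lceil>norm a\<rceil>) a" for a
  have \<Psi>: "\<Psi> a = \<psi> n a" if "norm a \<le> real n" for a :: 'a and n
    unfolding \<Psi>_def using that by (intro stable[symmetric]) linarith+
  have "unit_eigenfield S \<Psi>"
    unfolding unit_eigenfield_def
  proof (intro conjI allI)
    show "smooth \<Psi>"
    proof (rule smooth_locally)
      fix a :: 'a
      obtain n where "norm a < real n" using reals_Archimedean2 by blast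
      then show "\<exists>g U. smooth g \<and> open U \<and> a \<in> U \<and> (\<forall>x\<in>U. \<Psi> x = g x)"
        using \<psi>(1)[of n] \<Psi>
        by (intro exI[of _ "\<psi> n"] exI[of _ "ball 0 (real n)"]) (auto simp: unit_eigenfield_def)
    qed
    fix a :: 'a
    obtain n where "norm a < real n" using reals_Archimedean2 by blast
    then have "\<Psi> a = \<psi> n a" "\<rho> n a = a" using \<Psi> \<rho>(3) by auto
    then show "norm (\<Psi> a) = 1" "S a *v \<Psi> a = - \<Psi> a"
      using \<psi>(1)[of n] unfolding unit_eigenfield_def by metis+
  qed
  then show ?thesis using that by blast
qed

section \<open>Complex two by two matrices\<close>

lemma mat2_nth [simp]:
  "mat2 a b c d $ 1 $ 1 = a" "mat2 a b c d $ 1 $ 2 = b"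
  "mat2 a b c d $ 2 $ 1 = c" "mat2 a b c d $ 2 $ 2 = d"
  by (simp_all add: mat2_def)

lemma cmat2_eq_iff:
  "A = B \<longleftrightarrow> A$1$1 = B$1$1 \<and> A$1$2 = B$1$2 \<and> A$2$1 = B$2$1 \<and> A$2$2 = B$2$2" for A B :: cmat2
  unfolding vec_eq_iff forall_2 by blast

lemma mult_cmat2_nth [simp]: "(A ** B) $ i $ j = A$i$1 * B$1$j + A$i$2 * B$2$j" for A B :: cmat2
  by (simp add: matrix_matrix_mult_def sum_2)

lemma cmult_nth [simp]: "(c *\<^sub>M A) $ i $ j = c * A$i$j"
  by (simp add: cmult_def map_matrix_def)

lemma conj_transpose_nth [simp]: "conj_transpose A $ i $ j = cnj (A$j$i)"
  by (simp add: conj_transpose_def map_matrix_def transpose_def)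

lemma mat_1_nth [simp]:
  "(mat 1 :: cmat2) $ 1 $ 1 = 1" "(mat 1 :: cmat2) $ 1 $ 2 = 0"
  "(mat 1 :: cmat2) $ 2 $ 1 = 0" "(mat 1 :: cmat2) $ 2 $ 2 = 1"
  by (simp_all add: mat_def)

lemma cmat2_algebra:
  fixes A B C :: cmat2
  shows "(A ** B) ** C = A ** (B ** C)"
    "(A + B) ** C = A ** C + B ** C" "A ** (B + C) = A ** B + A ** C"
    "(A - B) ** C = A ** C - B ** C" "A ** (B - C) = A ** B - A ** C"
    "(- A) ** B = - (A ** B)" "A ** (- B) = - (A ** B)"
    "(c *\<^sub>M A) ** B = c *\<^sub>M (A ** B)" "A ** (c *\<^sub>M B) = c *\<^sub>M (A ** B)"
    "c *\<^sub>M (A + B) = c *\<^sub>M A + c *\<^sub>M B" "c *\<^sub>M (A - B) = c *\<^sub>M A - c *\<^sub>M B"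
    "c *\<^sub>M (- A) = - (c *\<^sub>M A)"
  by (simp_all add: cmat2_eq_iff algebra_simps)

lemma conj_transpose_mult: "conj_transpose (A ** B) = conj_transpose B ** conj_transpose A"
  by (simp add: cmat2_eq_iff)

lemma conj_transpose_conj_transpose: "conj_transpose (conj_transpose A) = A"
  by (simp add: cmat2_eq_iff)

lemma conj_transpose_minus: "conj_transpose (- A) = - conj_transpose A"
  by (simp add: cmat2_eq_iff)

lemma SU2_matrix_inv:
  assumes "A \<in> SU2"
  shows "matrix_inv A = conj_transpose A"
proof -
  have "\<exists>B. A ** B = mat 1 \<and> B ** A = mat 1"
    using assms by (auto simp: SU2_def)
  from someI_ex[OF this] have "A ** matrix_inv A = mat 1"
    by (simp add: matrix_inv_def)
  then have "(conj_transpose A ** A) ** matrix_inv A = conj_transpose A"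
    by (simp only: matrix_mul_assoc[symmetric] matrix_mul_rid)
  then show ?thesis using assms by (simp add: SU2_def)
qed

section \<open>Complex derivations and zero curvature\<close>

text \<open>All of \<open>\<partial>\<^sub>t\<close>, \<open>\<partial>\<^sub>z\<close> and its conjugate are combinations \<open>\<partial>\<^sub>v + c \<partial>\<^sub>w\<close> of two directional derivatives.
  Treating them uniformly gives the product rule, the commutation of two derivations and the
  effect of conjugation, \<open>c\<close> becoming its conjugate, once for all three.\<close>

definition cderiv :: "complex \<Rightarrow> 'a \<Rightarrow> 'a \<Rightarrow> ('a::real_normed_vector \<Rightarrow> complex) \<Rightarrow> 'a \<Rightarrow> complex" where
  "cderiv c v w f a = dirderiv v f a + c * dirderiv w f a"

definition mderiv :: "complex \<Rightarrow> 'a \<Rightarrow> 'a \<Rightarrow> ('a::real_normed_vector \<Rightarrow> cmat2) \<Rightarrow> 'a \<Rightarrow> cmat2" where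
  "mderiv c v w F a = dirderiv v F a + c *\<^sub>M dirderiv w F a"

lemma d_eq_cderiv:
  "d_t = cderiv 0 (1, 0, 0) 0" "d_z = cderiv (- \<i>) (0, 1, 0) (0, 0, 1)"
  "d_zb = cderiv \<i> (0, 1, 0) (0, 0, 1)"
  by (simp_all add: fun_eq_iff cderiv_def d_t_def d_z_def d_zb_def d_x_def d_y_def)

lemma D_eq_mderiv:
  "d_t = mderiv 0 (1, 0, 0) 0" "D_z = mderiv (- \<i>) (0, 1, 0) (0, 0, 1)"
  "D_zb = mderiv \<i> (0, 1, 0) (0, 0, 1)"
  by (simp_all add: fun_eq_iff mderiv_def d_t_def D_z_def D_zb_def d_x_def d_y_def cmat2_eq_iff)

lemma smooth_cderiv: "smooth f \<Longrightarrow> smooth (\<lambda>a. cderiv c v w f a)"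
  unfolding cderiv_def by (intro smooth_add smooth_mult smooth_const smooth_dirderiv)

lemma cderiv_linear:
  assumes "bounded_linear h" "\<And>z. h (c * z) = c' * h z" "smooth f"
  shows "cderiv c' v w (\<lambda>a. h (f a)) a = h (cderiv c v w f a)"
  using assms(2) linear_add[OF bounded_linear.linear[OF assms(1)]]
  by (simp add: cderiv_def dirderiv_linear[OF assms(1,3)])

lemma cderiv_const: "cderiv c v w (\<lambda>a. k) a = 0"
  by (simp add: cderiv_def)

lemma cderiv_mult_left: "smooth f \<Longrightarrow> cderiv c v w (\<lambda>a. k * f a) a = k * cderiv c v w f a"
  by (rule cderiv_linear[OF bounded_linear_mult_right]) simp_all

lemma cderiv_minus: "smooth f \<Longrightarrow> cderiv c v w (\<lambda>a. - f a) a = - cderiv c v w f a"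
  using cderiv_mult_left[of f c v w "-1" a] by simp

lemma cderiv_cnj: "smooth f \<Longrightarrow> cderiv c v w (\<lambda>a. cnj (f a)) a = cnj (cderiv (cnj c) v w f a)"
  by (rule cderiv_linear[OF bounded_linear_cnj]) simp_all

lemma cderiv_add:
  assumes "smooth f" "smooth g"
  shows "cderiv c v w (\<lambda>a. f a + g a) a = cderiv c v w f a + cderiv c v w g a"
proof -
  have "dirderiv x (\<lambda>a. f a + g a) a = dirderiv x f a + dirderiv x g a" for x
    unfolding frechet_derivative_at[OF has_derivative_add[OF assms[THEN smooth_has_derivative]], symmetric]
    ..
  then show ?thesis by (simp add: cderiv_def algebra_simps)
qed

lemma cderiv_diff:
  assumes "smooth f" "smooth g"
  shows "cderiv c v w (\<lambda>a. f a - g a) a = cderiv c v w f a - cderiv c v w g a"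
  using cderiv_add[OF assms(1) smooth_minus[OF assms(2)], of c v w a]
    cderiv_minus[OF assms(2), of c v w a] by simp

lemma cderiv_mult:
  assumes "smooth f" "smooth g"
  shows "cderiv c v w (\<lambda>a. f a * g a) a = cderiv c v w f a * g a + f a * cderiv c v w g a"
proof -
  have "((\<lambda>a. f a * g a) has_derivative (\<lambda>x. f a * dirderiv x g a + dirderiv x f a * g a)) (at a)"
    by (rule has_derivative_mult[OF smooth_has_derivative[OF assms(1)] smooth_has_derivative[OF assms(2)]])
  note * = fun_cong[OF frechet_derivative_at[OF this, symmetric]]
  have "cderiv c v w (\<lambda>a. f a * g a) a = (f a * dirderiv v g a + dirderiv v f a * g a)
      + c * (f a * dirderiv w g a + dirderiv w f a * g a)"
    unfolding cderiv_def * by (rule refl)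
  also have "\<dots> = cderiv c v w f a * g a + f a * cderiv c v w g a"
    unfolding cderiv_def by algebra
  finally show ?thesis .
qed

lemma cderiv_commute:
  assumes "smooth f"
  shows "cderiv c v w (\<lambda>a. cderiv c' v' w' f a) a = cderiv c' v' w' (\<lambda>a. cderiv c v w f a) a"
proof -
  have *: "cderiv k x y (\<lambda>a. cderiv l x' y' f a) a =
      (dirderiv x (\<lambda>a. dirderiv x' f a) a + l * dirderiv x (\<lambda>a. dirderiv y' f a) a)
      + k * (dirderiv y (\<lambda>a. dirderiv x' f a) a + l * dirderiv y (\<lambda>a. dirderiv y' f a) a)" for k l x y x' y'
  proof -
    have "((\<lambda>a. dirderiv x' f a + l * dirderiv y' f a) has_derivative
        (\<lambda>u. dirderiv u (\<lambda>a. dirderiv x' f a) a + l * dirderiv u (\<lambda>a. dirderiv y' f a) a)) (at a)"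
      by (intro has_derivative_add has_derivative_mult_right smooth_has_derivative smooth_dirderiv assms)
    from frechet_derivative_at[OF this, symmetric]
    show ?thesis by (simp only: cderiv_def)
  qed
  show ?thesis
    unfolding * dirderiv_commute[OF assms, where v = v' and u = v]
      dirderiv_commute[OF assms, where v = v' and u = w]
      dirderiv_commute[OF assms, where v = w' and u = v]
      dirderiv_commute[OF assms, where v = w' and u = w]
    by (simp add: algebra_simps)
qed

lemma smooth_mat2:
  assumes "smooth f" "smooth g" "smooth h" "smooth k"
  shows "smooth (\<lambda>a. mat2 (f a) (g a) (h a) (k a))"
proof -
  have lin: "bounded_linear (\<lambda>z. mat2 z 0 0 0)" "bounded_linear (\<lambda>z. mat2 0 z 0 0)"
    "bounded_linear (\<lambda>z. mat2 0 0 z 0)" "bounded_linear (\<lambda>z. mat2 0 0 0 z)"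
    unfolding linear_conv_bounded_linear[symmetric]
    by (rule linearI; simp add: cmat2_eq_iff)+
  have "smooth (\<lambda>a. mat2 (f a) 0 0 0 + mat2 0 (g a) 0 0 + mat2 0 0 (h a) 0 + mat2 0 0 0 (k a))"
    using assms by (intro smooth_add lin[THEN smooth_linear])
  moreover have "mat2 (f a) 0 0 0 + mat2 0 (g a) 0 0 + mat2 0 0 (h a) 0 + mat2 0 0 0 (k a)
      = mat2 (f a) (g a) (h a) (k a)" for a
    by (simp add: cmat2_eq_iff)
  ultimately show ?thesis by simp
qed

lemma smooth_cmat2_iff:
  "smooth F \<longleftrightarrow> (\<forall>i j. smooth (\<lambda>a. F a $ i $ j))"
  for F :: "'a::real_normed_vector \<Rightarrow> cmat2"
proof
  assume *: "\<forall>i j. smooth (\<lambda>a. F a $ i $ j)"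
  have "smooth (\<lambda>a. mat2 (F a $1$1) (F a $1$2) (F a $2$1) (F a $2$2))"
    using * by (intro smooth_mat2) auto
  moreover have "mat2 (F a $1$1) (F a $1$2) (F a $2$1) (F a $2$2) = F a" for a
    by (simp add: cmat2_eq_iff)
  ultimately show "smooth F" by simp
qed (auto intro: smooth_nth)

lemma mderiv_nth: "smooth F \<Longrightarrow> mderiv c v w F a $ i $ j = cderiv c v w (\<lambda>a. F a $ i $ j) a"
  using dirderiv_linear[OF bounded_linear_compose[OF bounded_linear_vec_nth bounded_linear_vec_nth], of F]
  by (simp add: mderiv_def cderiv_def)

lemma smooth_matrix_mult:
  fixes F G :: "'a::real_normed_vector \<Rightarrow> cmat2"
  shows "smooth F \<Longrightarrow> smooth G \<Longrightarrow> smooth (\<lambda>a. F a ** G a)"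
  by (subst smooth_cmat2_iff) (auto intro!: smooth_add smooth_mult smooth_nth)

lemma smooth_conj_transpose: "smooth F \<Longrightarrow> smooth (\<lambda>a. conj_transpose (F a))"
  by (subst smooth_cmat2_iff) (auto intro!: smooth_cnj smooth_nth)

lemma smooth_mderiv: "smooth F \<Longrightarrow> smooth (\<lambda>a. mderiv c v w F a)"
  by (subst smooth_cmat2_iff) (auto simp: mderiv_nth intro!: smooth_cderiv smooth_nth)

lemma mderiv_const: "mderiv c v w (\<lambda>a. K) a = 0"
  by (simp add: mderiv_def cmat2_eq_iff)

lemma mderiv_mult:
  assumes "smooth F" "smooth G"
  shows "mderiv c v w (\<lambda>a. F a ** G a) a = mderiv c v w F a ** G a + F a ** mderiv c v w G a"
  using assms
  by (simp add: cmat2_eq_iff mderiv_nth smooth_matrix_mult cderiv_add cderiv_mult smooth_mult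
      smooth_nth)

lemma mderiv_minus: "smooth F \<Longrightarrow> mderiv c v w (\<lambda>a. - F a) a = - mderiv c v w F a"
  by (simp add: cmat2_eq_iff mderiv_nth smooth_minus cderiv_minus smooth_nth)

lemma mderiv_conj_transpose:
  "smooth F \<Longrightarrow> mderiv c v w (\<lambda>a. conj_transpose (F a)) a = conj_transpose (mderiv (cnj c) v w F a)"
  by (simp add: cmat2_eq_iff mderiv_nth smooth_conj_transpose cderiv_cnj smooth_nth)

lemma mderiv_commute:
  "smooth F \<Longrightarrow> mderiv c v w (\<lambda>a. mderiv c' v' w' F a) a = mderiv c' v' w' (\<lambda>a. mderiv c v w F a) a"
  by (auto simp: cmat2_eq_iff mderiv_nth smooth_mderiv smooth_nth intro!: cderiv_commute)

text \<open>A frame \<open>G\<close> that satisfies two linear equations has commuting second derivatives. Expanding both of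
  them and cancelling \<open>G\<close> leaves an equation between the coefficients alone.\<close>

lemma zero_curvature:
  assumes smooth: "smooth G" "smooth A" "smooth B"
    and G1: "\<And>a. mderiv c v w G a = G a ** A a"
    and G2: "\<And>a. mderiv c' v' w' G a = G a ** B a"
    and inv: "H ** G a = mat 1"
  shows "mderiv c' v' w' A a + B a ** A a = mderiv c v w B a + A a ** B a"
proof -
  have "mderiv c' v' w' (\<lambda>a. G a ** A a) a = mderiv c v w (\<lambda>a. G a ** B a) a"
    using mderiv_commute[OF smooth(1), of c' v' w' c v w a] by (simp add: G1 G2)
  then have "G a ** (mderiv c' v' w' A a + B a ** A a) = G a ** (mderiv c v w B a + A a ** B a)"
    using smooth by (simp add: mderiv_mult G1 G2 cmat2_algebra algebra_simps)
  then have "(H ** G a) ** (mderiv c' v' w' A a + B a ** A a) = (H ** G a) ** (mderiv c v w B a + A a ** B a)"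
    by (simp only: matrix_mul_assoc[symmetric])
  then show ?thesis by (simp add: inv)
qed

section \<open>Frames in SU(2)\<close>

lemma SU2_nth:
  assumes "A \<in> SU2"
  shows "A$2$2 = cnj (A$1$1)" "A$2$1 = - cnj (A$1$2)"
proof -
  have A: "conj_transpose A ** A = mat 1" "det A = 1"
    using assms by (auto simp: SU2_def)
  \<comment> \<open>The adjugate of a matrix of determinant \<open>1\<close> is its inverse, here the conjugate transpose.\<close>
  have adj: "mat2 (A$2$2) (- A$1$2) (- A$2$1) (A$1$1) = conj_transpose A"
  proof -
    have "A ** mat2 (A$2$2) (- A$1$2) (- A$2$1) (A$1$1) = mat 1"
      using A(2) by (simp add: cmat2_eq_iff det_2 algebra_simps)
    then have "(conj_transpose A ** A) ** mat2 (A$2$2) (- A$1$2) (- A$2$1) (A$1$1) = conj_transpose A"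
      by (simp only: matrix_mul_assoc[symmetric] matrix_mul_rid)
    then show ?thesis by (simp add: A(1))
  qed
  show "A$2$2 = cnj (A$1$1)"
    using arg_cong[OF adj, of "\<lambda>B. B$1$1"] by simp
  show "A$2$1 = - cnj (A$1$2)"
    using arg_cong[OF adj, of "\<lambda>B. - B$2$1"] by simp
qed

lemma SU2_unitary:
  assumes "A \<in> SU2"
  shows "conj_transpose A ** A = mat 1" "A ** conj_transpose A = mat 1"
    "conj_transpose A ** (A ** B) = B" "A ** (conj_transpose A ** B) = B"
  using assms by (simp_all add: SU2_def matrix_mul_assoc)

text \<open>The trace of a logarithmic derivative is the derivative of the determinant, which is constant.\<close>

lemma SU2_logderiv_traceless:
  fixes G :: "'a::real_normed_vector \<Rightarrow> cmat2"
  assumes "smooth G" and SU2: "range G \<subseteq> SU2"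
  shows "(conj_transpose (G a) ** mderiv c v w G a) $ 2 $ 2
    = - (conj_transpose (G a) ** mderiv c v w G a) $ 1 $ 1"
proof -
  let ?f = "\<lambda>a. G a $1$1" and ?g = "\<lambda>a. G a $1$2"
  have sm: "smooth ?f" "smooth ?g" "smooth (\<lambda>a. cnj (?f a))" "smooth (\<lambda>a. cnj (?g a))"
    using assms(1) by (auto intro!: smooth_nth smooth_cnj)
  have "G a \<in> SU2" for a using SU2 by blast
  note G = SU2_nth[OF this]
  have "?f a * cnj (?f a) + ?g a * cnj (?g a) = 1" for a
  proof -
    have "det (G a) = 1" using SU2 unfolding SU2_def by blast
    then show ?thesis by (simp add: det_2 G)
  qed
  then have "0 = cderiv c v w (\<lambda>a. ?f a * cnj (?f a) + ?g a * cnj (?g a)) a"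
    by (simp add: cderiv_const)
  also have "\<dots> = cderiv c v w ?f a * cnj (?f a) + ?f a * cderiv c v w (\<lambda>a. cnj (?f a)) a
     + (cderiv c v w ?g a * cnj (?g a) + ?g a * cderiv c v w (\<lambda>a. cnj (?g a)) a)"
    by (simp add: cderiv_add cderiv_mult smooth_mult sm)
  finally show ?thesis
    using assms(1) sm by (simp add: mderiv_nth G cderiv_minus algebra_simps eq_neg_iff_add_eq_0)
qed

text \<open>Differentiating \<open>G\<^sup>* G = 1\<close> shows that the logarithmic derivative along a real direction is
  skew-Hermitian. For a complex derivation the adjoint goes with the conjugate derivation.\<close>

lemma SU2_logderiv_adjoint:
  fixes G :: "'a::real_normed_vector \<Rightarrow> cmat2"
  assumes "smooth G" and SU2: "range G \<subseteq> SU2"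
  shows "conj_transpose (G a) ** mderiv (cnj c) v w G a
    = - conj_transpose (conj_transpose (G a) ** mderiv c v w G a)"
proof -
  have "(\<lambda>a. conj_transpose (G a) ** G a) = (\<lambda>a. mat 1)"
    using SU2 SU2_unitary(1) by fastforce
  then have "0 = mderiv (cnj c) v w (\<lambda>a. conj_transpose (G a) ** G a) a"
    by (simp add: mderiv_const)
  also have "\<dots> = conj_transpose (mderiv c v w G a) ** G a + conj_transpose (G a) ** mderiv (cnj c) v w G a"
    using assms(1) by (simp add: mderiv_mult mderiv_conj_transpose smooth_conj_transpose)
  finally show ?thesis
    by (simp add: conj_transpose_mult conj_transpose_conj_transpose eq_neg_iff_add_eq_0 add.commute)
qed

section \<open>Diagonalization of spin fields\<close>

lemma SU2_of_unit_column:
  assumes "\<alpha> * cnj \<alpha> + \<beta> * cnj \<beta> = 1"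
  shows "mat2 \<alpha> (- cnj \<beta>) \<beta> (cnj \<alpha>) \<in> SU2"
  using assms by (simp add: SU2_def cmat2_eq_iff det_2 algebra_simps)

text \<open>A traceless Hermitian matrix is determined by one unit eigenvector and its eigenvalue. The second
  column of \<open>G\<close> spans the orthogonal complement, with the phase for which the determinant is \<open>1\<close>.\<close>

lemma spin_matrix_diagonalization:
  assumes "norm \<psi> = 1" "spin_matrix s *v \<psi> = - \<psi>"
  defines "G \<equiv> mat2 (\<psi>$1) (- cnj (\<psi>$2)) (\<psi>$2) (cnj (\<psi>$1))"
  shows "G \<in> SU2" "spin_matrix s = - (G ** sigma3 ** conj_transpose G)"
proof -
  define \<alpha> \<beta> where "\<alpha> = \<psi>$1" and "\<beta> = \<psi>$2"
  define c w where "c = complex_of_real (s$3)" and "w = Complex (s$1) (s$2)"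
  have S: "spin_matrix s = mat2 c w (cnj w) (- c)"
    by (simp add: spin_matrix_def c_def w_def complex_eq_iff cmat2_eq_iff)
  have "(norm \<psi>)\<^sup>2 = (cmod \<alpha>)\<^sup>2 + (cmod \<beta>)\<^sup>2"
    by (simp add: norm_vec_def L2_set_def sum_2 \<alpha>_def \<beta>_def)
  then have "complex_of_real ((cmod \<alpha>)\<^sup>2 + (cmod \<beta>)\<^sup>2) = 1"
    using assms(1) by simp
  then have unit: "\<alpha> * cnj \<alpha> + \<beta> * cnj \<beta> = 1"
    by (simp only: of_real_add complex_norm_square)
  then show "G \<in> SU2" unfolding G_def \<alpha>_def \<beta>_def by (rule SU2_of_unit_column)
  have eig: "c * \<alpha> + w * \<beta> = - \<alpha>" "cnj w * \<alpha> - c * \<beta> = - \<beta>"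
    using assms(2) by (auto simp: S vec_eq_iff forall_2 matrix_vector_mult_def sum_2 \<alpha>_def \<beta>_def)
  have eig': "c * cnj \<alpha> + cnj w * cnj \<beta> = - cnj \<alpha>" "w * cnj \<alpha> - c * cnj \<beta> = - cnj \<beta>"
    using eig[THEN arg_cong[where f = cnj]] by (auto simp: c_def)
  \<comment> \<open>Each of \<open>c\<close> and \<open>w\<close> is multiplied by the unit norm and regrouped into the four eigenvector equations.\<close>
  have "2 * c = 2 * (c * (\<alpha> * cnj \<alpha> + \<beta> * cnj \<beta>))"
    by (simp add: unit)
  also have "\<dots> = (c * \<alpha> + w * \<beta>) * cnj \<alpha> - (cnj w * \<alpha> - c * \<beta>) * cnj \<beta>
      + (c * cnj \<alpha> + cnj w * cnj \<beta>) * \<alpha> - (w * cnj \<alpha> - c * cnj \<beta>) * \<beta>"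
    by (simp add: algebra_simps)
  also have "\<dots> = 2 * (\<beta> * cnj \<beta> - \<alpha> * cnj \<alpha>)"
    by (simp only: eig eig') (simp add: algebra_simps)
  finally have "c = \<beta> * cnj \<beta> - \<alpha> * cnj \<alpha>"
    by (simp only: mult_cancel_left) simp
  moreover have "w = w * (\<alpha> * cnj \<alpha> + \<beta> * cnj \<beta>)"
    by (simp add: unit)
  then have "w = (w * cnj \<alpha> - c * cnj \<beta>) * \<alpha> + (c * \<alpha> + w * \<beta>) * cnj \<beta>"
    by (simp add: algebra_simps)
  then have "w = - (2 * \<alpha> * cnj \<beta>)"
    by (simp only: eig eig') (simp add: algebra_simps)
  ultimately show "spin_matrix s = - (G ** sigma3 ** conj_transpose G)"
    by (simp add: S cmat2_eq_iff G_def \<alpha>_def \<beta>_def sigma3_def)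
qed

lemma spin_matrix_eigenvector:
  assumes "spin_matrix s ** spin_matrix s = mat 1"
  obtains v where "norm v = 1" "spin_matrix s *v v = - v"
proof -
  have "\<exists>x. x - spin_matrix s *v x \<noteq> 0"
  proof (rule ccontr)
    assume "\<not> ?thesis"
    then have "spin_matrix s *v x = mat 1 *v x" for x by auto
    then have "spin_matrix s = mat 1" by (metis matrix_eq)
    then have "Re (spin_matrix s $1$1) = 1" "Re (spin_matrix s $2$2) = 1" by simp_all
    then show False by (simp add: spin_matrix_def)
  qed
  then obtain x where x: "x - spin_matrix s *v x \<noteq> 0" by blast
  define v where "v = sgn (x - spin_matrix s *v x)"
  have "norm v = 1" using x by (simp add: v_def norm_sgn)
  moreover have "spin_matrix s *v (x - spin_matrix s *v x) = - (x - spin_matrix s *v x)"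
    by (simp add: matrix_vector_mult_diff_distrib matrix_vector_mul_assoc assms)
  then have "spin_matrix s *v v = - v"
    unfolding v_def by (rule matrix_vector_mult_sgn)
  ultimately show ?thesis using that by blast
qed

lemma exists_SU2_diagonalization:
  assumes "smooth S" "spin_field S s"
  obtains G where "smooth G" "range G \<subseteq> SU2" "\<And>a. S a = - (G a ** sigma3 ** conj_transpose (G a))"
proof -
  have S: "S a = spin_matrix (s a)" "S a ** S a = mat 1" for a
    using assms(2) unfolding spin_field_def by blast+
  obtain v where "norm v = 1" "S 0 *v v = - v"
    using spin_matrix_eigenvector[of "s 0"] S[of 0] by metis
  then obtain \<psi> where "unit_eigenfield S \<psi>"
    using exists_unit_eigenfield[OF assms(1) S(2)] by blast
  then have \<psi>: "smooth \<psi>" "norm (\<psi> a) = 1" "spin_matrix (s a) *v \<psi> a = - \<psi> a" for a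
    unfolding unit_eigenfield_def S(1) by blast+
  show ?thesis
  proof
    show "smooth (\<lambda>a. mat2 (\<psi> a$1) (- cnj (\<psi> a$2)) (\<psi> a$2) (cnj (\<psi> a$1)))"
      using \<psi>(1) by (intro smooth_mat2 smooth_minus smooth_cnj smooth_nth)
    show "range (\<lambda>a. mat2 (\<psi> a$1) (- cnj (\<psi> a$2)) (\<psi> a$2) (cnj (\<psi> a$1))) \<subseteq> SU2"
      using spin_matrix_diagonalization(1)[OF \<psi>(2,3)] by blast
  qed (simp only: S(1) spin_matrix_diagonalization(2)[OF \<psi>(2,3)])
qed

section \<open>The moving frame of a Landau-Lifshitz solution\<close>

lemma D_nth:
  assumes "smooth F"
  shows "d_t F a $ i $ j = d_t (\<lambda>a. F a $ i $ j) a" "D_z F a $ i $ j = d_z (\<lambda>a. F a $ i $ j) a"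
    "D_zb F a $ i $ j = d_zb (\<lambda>a. F a $ i $ j) a"
  using assms by (simp_all add: D_eq_mderiv d_eq_cderiv mderiv_nth)

lemma d_zb_d_z_commute: "smooth f \<Longrightarrow> d_z (d_zb f) a = d_zb (d_z f) a"
  unfolding d_eq_cderiv by (rule cderiv_commute)

text \<open>The conjugate derivative of the frame and the derivatives of the adjoint frame are all governed by
  the same two coefficients \<open>U\<close> and \<open>V\<close>, because \<open>G\<close> is unitary. Tracelessness is what gives \<open>U\<close> the
  shape required of the matrix with entries \<open>p, q, r, -p\<close>.\<close>

lemma frame_equations:
  fixes G U V :: "point \<Rightarrow> cmat2"
  assumes G: "smooth G" "range G \<subseteq> SU2"
    and U: "\<And>a. U a = - (conj_transpose (G a) ** D_z G a)"
    and V: "\<And>a. V a = conj_transpose (G a) ** d_t G a"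
  shows "smooth U" "smooth V"
    and "D_z G a = - (G a ** U a)" "D_zb G a = G a ** conj_transpose (U a)" "d_t G a = G a ** V a"
    and "D_z (\<lambda>a. conj_transpose (G a)) a = U a ** conj_transpose (G a)"
    and "D_zb (\<lambda>a. conj_transpose (G a)) a = - (conj_transpose (U a) ** conj_transpose (G a))"
    and "d_t (\<lambda>a. conj_transpose (G a)) a = - (V a ** conj_transpose (G a))"
    and "conj_transpose (V a) = - V a" "U a $ 2 $ 2 = - U a $ 1 $ 1" "V a $ 2 $ 2 = - V a $ 1 $ 1"
proof -
  have SU2: "G a \<in> SU2" for a using G(2) by blast
  note unitary = SU2_unitary[OF SU2]
  have "U = (\<lambda>a. - (conj_transpose (G a) ** D_z G a))" "V = (\<lambda>a. conj_transpose (G a) ** d_t G a)"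
    using U V by blast+
  then show "smooth U" "smooth V"
    using G(1) by (auto simp: D_eq_mderiv intro!: smooth_minus smooth_matrix_mult smooth_conj_transpose smooth_mderiv)
  show z: "D_z G a = - (G a ** U a)" and t: "d_t G a = G a ** V a" for a
    by (simp_all add: U V cmat2_algebra unitary)
  have Gzb: "conj_transpose (G a) ** D_zb G a = conj_transpose (U a)" for a
    using SU2_logderiv_adjoint[OF G, of a "- \<i>" "(0, 1, 0)" "(0, 0, 1)"]
    by (simp add: U D_eq_mderiv conj_transpose_minus)
  show zb: "D_zb G a = G a ** conj_transpose (U a)" for a
    using arg_cong[OF Gzb[of a], of "\<lambda>A. G a ** A"] by (simp add: unitary)
  show adj: "conj_transpose (V a) = - V a" for a
    using SU2_logderiv_adjoint[OF G, of a 0 "(1, 0, 0)" 0]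
    unfolding V D_eq_mderiv complex_cnj_zero by (metis minus_minus)
  show "D_z (\<lambda>a. conj_transpose (G a)) a = U a ** conj_transpose (G a)"
    using zb[of a] G(1)
    by (simp add: D_eq_mderiv mderiv_conj_transpose conj_transpose_mult conj_transpose_conj_transpose)
  show "D_zb (\<lambda>a. conj_transpose (G a)) a = - (conj_transpose (U a) ** conj_transpose (G a))"
    using z[of a] G(1)
    by (simp add: D_eq_mderiv mderiv_conj_transpose conj_transpose_mult conj_transpose_minus)
  show "d_t (\<lambda>a. conj_transpose (G a)) a = - (V a ** conj_transpose (G a))"
    using t[of a] G(1) adj[of a]
    by (simp add: D_eq_mderiv mderiv_conj_transpose conj_transpose_mult cmat2_algebra)
  show "U a $ 2 $ 2 = - U a $ 1 $ 1"
    using SU2_logderiv_traceless[OF G, of a "- \<i>" "(0, 1, 0)" "(0, 0, 1)"]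
    by (simp only: U D_eq_mderiv vector_uminus_component)
  show "V a $ 2 $ 2 = - V a $ 1 $ 1"
    using SU2_logderiv_traceless[OF G, of a 0 "(1, 0, 0)" 0]
    by (simp only: V D_eq_mderiv)
qed

text \<open>In the frame \<open>G\<close> the field \<open>S\<close> becomes the constant \<open>- \<sigma>\<^sub>3\<close>, and its derivatives become commutators
  with the coefficients of the frame, while differentiation acts on a conjugated matrix as a
  covariant derivative. Conjugating the equation by \<open>G\<close> thus leaves a relation between \<open>U\<close> and \<open>V\<close>.
  A commutator with \<open>\<sigma>\<^sub>3\<close> only has off-diagonal entries, so exactly the off-diagonal part of \<open>V\<close> is
  determined.\<close>

lemma landau_lifshitz_in_frame:
  fixes G U V :: "point \<Rightarrow> cmat2"
  assumes G: "smooth G" "range G \<subseteq> SU2"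
    and U: "\<And>a. U a = - (conj_transpose (G a) ** D_z G a)"
    and V: "\<And>a. V a = conj_transpose (G a) ** d_t G a"
    and S: "\<And>a. S a = - (G a ** sigma3 ** conj_transpose (G a))"
    and LL: "landau_lifshitz S"
  defines "M \<equiv> \<lambda>a. commutator (U a) sigma3"
  shows "commutator (V a) sigma3
    = (\<i> / 2) *\<^sub>M commutator sigma3 (D_zb M a + commutator (conj_transpose (U a)) (M a))"
proof -
  have SU2: "G a \<in> SU2" for a using G(2) by blast
  note unitary = SU2_unitary[OF SU2]
  note frame = frame_equations[OF G U V]
  let ?X = "\<lambda>a. D_zb M a + commutator (conj_transpose (U a)) (M a)"
  have smooth: "smooth (\<lambda>a. conj_transpose (G a))" "smooth (\<lambda>a. sigma3 ** conj_transpose (G a))"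
    "smooth M" "smooth (\<lambda>a. M a ** conj_transpose (G a))"
    using G(1) frame(1) unfolding M_def commutator_def
    by (auto intro!: smooth_conj_transpose smooth_matrix_mult smooth_diff smooth_const)
  have S': "S = (\<lambda>a. - (G a ** (sigma3 ** conj_transpose (G a))))"
    using S by (simp add: cmat2_algebra fun_eq_iff)
  have "D_z S a = G a ** (M a ** conj_transpose (G a))" for a
    using G(1) smooth frame(3,6)[of a]
    by (simp add: S' D_eq_mderiv mderiv_minus mderiv_mult smooth_matrix_mult mderiv_const smooth_const
        M_def commutator_def cmat2_algebra)
  then have "D_z S = (\<lambda>a. G a ** (M a ** conj_transpose (G a)))" by blast
  then have zbz: "D_zb (D_z S) a = G a ** (?X a ** conj_transpose (G a))"
    using G(1) smooth frame(4,7)[of a]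
    by (simp add: D_eq_mderiv mderiv_mult commutator_def cmat2_algebra)
  have "d_t S a = - (G a ** (commutator (V a) sigma3 ** conj_transpose (G a)))"
    using G(1) smooth frame(5,8)[of a]
    by (simp add: S' D_eq_mderiv mderiv_minus mderiv_mult smooth_matrix_mult mderiv_const smooth_const
        commutator_def cmat2_algebra)
  moreover have "commutator (S a) (D_zb (D_z S) a)
      = - (G a ** (commutator sigma3 (?X a) ** conj_transpose (G a)))"
    unfolding zbz by (simp add: S' commutator_def cmat2_algebra unitary del: minus_add_distrib)
  ultimately have "G a ** (commutator (V a) sigma3 ** conj_transpose (G a))
      = G a ** (((\<i> / 2) *\<^sub>M commutator sigma3 (?X a)) ** conj_transpose (G a))"
    using LL unfolding landau_lifshitz_def by (simp add: cmat2_algebra)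
  from arg_cong[OF this, of "\<lambda>A. (conj_transpose (G a) ** A) ** G a"]
  show ?thesis by (simp add: cmat2_algebra unitary)
qed

theorem theorem1:
  fixes S :: "point \<Rightarrow> cmat2" and s :: "point \<Rightarrow> real^3"
  assumes "smooth S"
    and "spin_field S s"
    and "landau_lifshitz S"
  shows "\<exists>(G :: point \<Rightarrow> cmat2) (p :: point \<Rightarrow> complex) (q :: point \<Rightarrow> complex)
            (r :: point \<Rightarrow> complex) (u :: point \<Rightarrow> real).
           smooth G \<and> range G \<subseteq> SU2 \<and>
           smooth p \<and> smooth q \<and> smooth r \<and> smooth u \<and>
           gauge_transformation G S p q r u \<and>
           nls_system p q r u \<and> nls_restrictions p q r"
proof -
  \<comment> \<open>Any smooth diagonalization is a valid gauge function: another one differs by a diagonal factor,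
     which changes \<open>q\<close> and \<open>r\<close> by phases and \<open>p\<close> and \<open>u\<close> by derivatives of the phase.\<close>
  obtain G where G: "smooth G" "range G \<subseteq> SU2"
    and S: "\<And>a. S a = - (G a ** sigma3 ** conj_transpose (G a))"
    using exists_SU2_diagonalization[OF assms(1,2)] by blast
  have SU2: "G a \<in> SU2" for a using G(2) by blast
  note unitary = SU2_unitary[OF SU2]
  define U where "U a = - (conj_transpose (G a) ** D_z G a)" for a
  define V where "V a = conj_transpose (G a) ** d_t G a" for a
  note frame = frame_equations[OF G U_def V_def]
  define p q r u where "p a = U a $1$1" and "q a = U a $1$2" and "r a = U a $2$1"
    and "u a = Re (\<i> * V a $1$1)" for a
  have U_nth: "U a $1$1 = p a" "U a $1$2 = q a" "U a $2$1 = r a" "U a $2$2 = - p a" for a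
    by (simp_all add: p_def q_def r_def frame(10))
  have smooth: "smooth p" "smooth q" "smooth r"
    using frame(1) by (auto simp: p_def[abs_def] q_def[abs_def] r_def[abs_def] intro!: smooth_nth)
  have "smooth (\<lambda>a. Re (\<i> * V a $1$1))"
    using frame(2) by (intro smooth_Re smooth_mult smooth_const smooth_nth)
  then have smooth_u: "smooth u" by (simp add: u_def[abs_def])
  note sm = smooth smooth_u smooth[THEN smooth_cnj] smooth_of_real[OF smooth_u]
    smooth_mult smooth_add smooth_diff smooth_minus smooth_const smooth_cderiv

  \<comment> \<open>\<open>W\<close> is the matrix that the gauge transformation prescribes for \<open>\<i> V\<close>.\<close>
  define W where "W = (\<lambda>a. mat2 (of_real (u a)) (- d_zb q a - 2 * (cnj (p a) * q a))
     (d_zb r a - 2 * (cnj (p a) * r a)) (- of_real (u a)))"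
  have W_nth: "W a $1$1 = of_real (u a)" "W a $1$2 = - d_zb q a - 2 * (cnj (p a) * q a)"
    "W a $2$1 = d_zb r a - 2 * (cnj (p a) * r a)" "W a $2$2 = - of_real (u a)" for a
    by (simp_all add: W_def)
  have V_eq: "V a = (- \<i>) *\<^sub>M W a" for a
  proof -
    define M where "M = (\<lambda>a. commutator (U a) sigma3)"
    have M: "M = (\<lambda>a. mat2 0 (- 2 * q a) (2 * r a) 0)"
      by (simp add: M_def fun_eq_iff cmat2_eq_iff commutator_def sigma3_def U_nth)
    have DM: "D_zb M a = mat2 0 (- 2 * d_zb q a) (2 * d_zb r a) 0"
      by (simp add: M D_eq_mderiv d_eq_cderiv cmat2_eq_iff mderiv_nth smooth_mat2 sm cderiv_const
          cderiv_minus cderiv_mult_left)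
    have "commutator (V a) sigma3
        = (\<i> / 2) *\<^sub>M commutator sigma3 (D_zb M a + commutator (conj_transpose (U a)) (M a))"
      unfolding M_def by (rule landau_lifshitz_in_frame[OF G U_def V_def S assms(3)])
    then have "commutator (V a) sigma3 = (\<i> / 2) *\<^sub>M commutator sigma3
        (mat2 0 (- 2 * d_zb q a) (2 * d_zb r a) 0
          + commutator (conj_transpose (U a)) (mat2 0 (- 2 * q a) (2 * r a) 0))"
      by (simp only: DM) (simp only: M)
    then have "- 2 * V a $1$2 = \<i> / 2 * (2 * (- 2 * d_zb q a - 4 * (cnj (p a) * q a)))"
      "2 * V a $2$1 = \<i> / 2 * (- 2 * (2 * d_zb r a - 4 * (cnj (p a) * r a)))"
      by (simp_all add: cmat2_eq_iff commutator_def sigma3_def U_nth algebra_simps)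
    then have "2 * V a $1$2 = 2 * (- \<i> * W a $1$2)" "2 * V a $2$1 = 2 * (- \<i> * W a $2$1)"
      by (simp_all add: W_def algebra_simps)
    then have offdiag: "V a $1$2 = - \<i> * W a $1$2" "V a $2$1 = - \<i> * W a $2$1"
      by (simp_all only: mult_cancel_left) simp_all
    \<comment> \<open>The diagonal of \<open>V\<close> is imaginary, which is why \<open>u\<close>, defined as a real part, loses nothing.\<close>
    have "cnj (V a $1$1) = - V a $1$1"
      using arg_cong[OF frame(9), of "\<lambda>A. A$1$1" a] by simp
    then have "Re (V a $1$1) = 0" by (simp add: complex_eq_iff)
    then have "V a $1$1 = - \<i> * of_real (u a)"
      by (simp add: u_def complex_eq_iff)
    then show ?thesis
      using offdiag frame(11)[of a] by (simp add: cmat2_eq_iff W_def)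
  qed

  have "gauge_transformation G S p q r u"
    unfolding gauge_transformation_def
  proof (intro allI conjI)
    fix a
    show "S a = - (G a ** sigma3 ** matrix_inv (G a))"
      using S SU2_matrix_inv[OF SU2] by simp
    show "D_z G a = - (G a ** gauge_U p q r a)"
      using frame(3) by (simp add: gauge_U_def cmat2_eq_iff U_nth)
    have "D_zb (gauge_U_off q r) a = mat2 0 (d_zb q a) (d_zb r a) 0"
      by (simp add: gauge_U_off_def[abs_def] D_eq_mderiv d_eq_cderiv cmat2_eq_iff mderiv_nth
          smooth_mat2 sm cderiv_const)
    then have "(of_real (u a) *\<^sub>M mat 1 + D_zb (gauge_U_off q r) a) ** sigma3 + gauge_Q p q r a = W a"
      by (simp add: cmat2_eq_iff W_def sigma3_def gauge_Q_def)
    then show "d_t G a = (- \<i>) *\<^sub>M (G a **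
       ((of_real (u a) *\<^sub>M mat 1 + D_zb (gauge_U_off q r) a) ** sigma3 + gauge_Q p q r a))"
      using frame(5)[of a] V_eq[of a] by (simp add: cmat2_algebra)
  qed

  moreover have "nls_restrictions p q r"
  proof -
    \<comment> \<open>Compatibility of \<open>G\<^sub>z = - G U\<close> with the conjugate equation: its first row is the two restrictions.\<close>
    have "D_zb (\<lambda>a. - U a) a + conj_transpose (U a) ** (- U a)
        = D_z (\<lambda>a. conj_transpose (U a)) a + (- U a) ** conj_transpose (U a)" for a
      unfolding D_eq_mderiv
      by (rule zero_curvature[OF G(1), where H = "conj_transpose (G a)"])
        (use frame(1,3,4) in \<open>auto simp: D_eq_mderiv cmat2_algebra unitary
          intro!: smooth_minus smooth_conj_transpose\<close>)
    then have "- D_zb U a - conj_transpose (U a) ** U a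
        = D_z (\<lambda>a. conj_transpose (U a)) a - U a ** conj_transpose (U a)" for a
      using frame(1) by (simp add: D_eq_mderiv mderiv_minus cmat2_algebra)
    note this[THEN arg_cong, of "\<lambda>A. A$1$1"] this[THEN arg_cong, of "\<lambda>A. A$1$2"]
    then have "- d_zb p a - (cnj (p a) * p a + cnj (r a) * r a)
          = d_z (\<lambda>a. cnj (p a)) a - (p a * cnj (p a) + q a * cnj (q a))"
      "- d_zb q a - (cnj (p a) * q a - cnj (r a) * p a)
          = d_z (\<lambda>a. cnj (r a)) a - (p a * cnj (r a) - q a * cnj (p a))" for a
      using frame(1) by (simp_all add: D_nth smooth_conj_transpose U_nth)
    then show ?thesis
      unfolding nls_restrictions_def complex_norm_square by (simp add: algebra_simps)
  qed

  moreover have "nls_system p q r u"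
  proof -
    have smooth_W: "smooth W"
      unfolding W_def d_eq_cderiv by (intro smooth_mat2 sm)
    \<comment> \<open>Compatibility of \<open>G\<^sub>z = - G U\<close> with \<open>G\<^sub>t = G V\<close>: three of its entries are the evolution equations.\<close>
    have "d_t (\<lambda>a. - U a) a + V a ** (- U a) = D_z V a + (- U a) ** V a" for a
      unfolding D_eq_mderiv
      by (rule zero_curvature[OF G(1), where H = "conj_transpose (G a)"])
        (use frame(1,2,3,5) in \<open>auto simp: D_eq_mderiv cmat2_algebra unitary
          intro!: smooth_minus\<close>)
    then have "d_t U a = - D_z V a + commutator (U a) (V a)" for a
      using frame(1) by (simp add: D_eq_mderiv mderiv_minus cmat2_algebra commutator_def algebra_simps)
    moreover have "D_z V a = (- \<i>) *\<^sub>M D_z W a" for a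
      using smooth_W
      by (simp add: cmat2_eq_iff D_eq_mderiv mderiv_nth mderiv_nth[OF frame(2)] V_eq cderiv_minus cderiv_mult_left sm smooth_nth)
    ultimately have "d_t U a = (- \<i>) *\<^sub>M (commutator (U a) (W a) - D_z W a)" for a
      by (simp add: V_eq commutator_def cmat2_algebra)
    then have "\<i> *\<^sub>M d_t U a = commutator (U a) (W a) - D_z W a" for a
      by (simp add: cmat2_eq_iff)
    note this[THEN arg_cong, of "\<lambda>A. A$1$1"] this[THEN arg_cong, of "\<lambda>A. A$1$2"]
      this[THEN arg_cong, of "\<lambda>A. A$2$1"]
    then have diag: "\<i> * d_t p a = q a * W a $2$1 - W a $1$2 * r a - d_z (\<lambda>a. of_real (u a)) a"
      and upper: "\<i> * d_t q a = 2 * p a * W a $1$2 - 2 * of_real (u a) * q a - d_z (\<lambda>a. W a $1$2) a"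
      and lower: "\<i> * d_t r a = 2 * of_real (u a) * r a - 2 * p a * W a $2$1 - d_z (\<lambda>a. W a $2$1) a" for a
      using frame(1) smooth_W by (simp_all add: D_nth U_nth commutator_def W_nth algebra_simps)
    have W12: "d_z (\<lambda>a. W a $1$2) a = - d_zb (d_z q) a - 2 * d_z (\<lambda>a. cnj (p a) * q a) a" for a
      using d_zb_d_z_commute[OF smooth(2), of a]
      by (simp add: W_nth d_eq_cderiv cderiv_diff cderiv_minus cderiv_mult_left sm)
    have W21: "d_z (\<lambda>a. W a $2$1) a = d_zb (d_z r) a - 2 * d_z (\<lambda>a. cnj (p a) * r a) a" for a
      using d_zb_d_z_commute[OF smooth(3), of a]
      by (simp add: W_nth d_eq_cderiv cderiv_diff cderiv_mult_left sm)
    have qr: "d_zb (\<lambda>b. q b * r b) a = d_zb q a * r a + q a * d_zb r a" for a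
      unfolding d_eq_cderiv by (rule cderiv_mult[OF smooth(2,3)])
    show ?thesis
      unfolding nls_system_def complex_norm_square diag upper lower W12 W21 qr
      unfolding W_nth by (simp add: algebra_simps)
  qed

  ultimately show ?thesis
    using G smooth smooth_u by blast
qed

end
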